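(* Let $B$ be a noetherian normal $\mathbb{Q}$-domain graded by a finitely generated abelian group $G$. (a) If $H \in \mathbb{T}(B)$ then $\big(B^{(H)}, B^{(H+\bar{\mathbb{G}}(B))}\big) \in \mathrm{EXT}$. (b) If $H \in \mathcal{X}(B)$ then $H + \bar{\mathbb{G}}(B) \in \mathcal{X}(B)$.
   Context: Rings are commutative, associative and unital; "domain" means integral domain; a $\mathbb{Q}$-domain is a domain that is a $\mathbb{Q}$-algebra; a domain is normal if it is integrally closed in its field of fractions. For an abelian group $G$ (written additively), a $G$-graded ring is a ring $B=\bigoplus_{i\in G}B_i$ with $B_iB_j\subseteq B_{i+j}$. For a $G$-graded domain $B$, $\mathbb{G}(B)$ is the subgroup of $G$ generated by $\{i\in G : B_i\neq 0\}$. For a subgroup $H$ of $G$, $B^{(H)}=\bigoplus_{i\in H}B_i$, an $H$-graded ring. $\mathbb{T}(B)$ is the set of subgroups $H$ of $G$ such that $\mathbb{G}(B)/(H\cap\mathbb{G}(B))$ is a torsion group. Let $\mathrm{Spec}^1(B)$ be the set of all prime ideals of $B$ of height $1$ (not necessarily homogeneous). For $\mathfrak{p}\in\mathrm{Spec}(B)$, $\mathbb{M}(B,\mathfrak{p})=\{i\in G: B_i\nsubseteq\mathfrak{p}\}$, a submonoid of $\mathbb{G}(B)$, and $\overline{\mathbb{M}}(B,\mathfrak{p})$ is the subgroup it generates. Define $\bar{\mathbb{G}}(B)=\bigcap_{\mathfrak{p}\in\mathrm{Spec}^1(B)}\overline{\mathbb{M}}(B,\mathfrak{p})$ if $\mathrm{Spec}^1(B)\neq\emptyset$,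 and $\bar{\mathbb{G}}(B)=\mathbb{G}(B)$ if $\mathrm{Spec}^1(B)=\emptyset$. $(A,B)\in\mathrm{EXT}$ means: $A$ is a ring, $B$ is an $A$-algebra with structure map $\phi:A\to B$, and for every derivation $\delta:A\to A$ there exists a unique derivation $D:B\to B$ such that $D\circ\phi=\phi\circ\delta$. For subgroups $H\subseteq H'$ of $G$, $B^{(H')}$ is viewed as a $B^{(H)}$-algebra by inclusion. A derivation $D:B\to B$ is locally nilpotent if for each $b\in B$ there is $n>0$ with $D^n(b)=0$; it is homogeneous if there is $d$ in the grading group with $D(B_i)\subseteq B_{i+d}$ for all $i$. $\mathrm{HLND}(B)$ is the set of homogeneous locally nilpotent derivations of a graded ring $B$. $\mathcal{X}(B)=\{H\in\mathbb{T}(B):\mathrm{HLND}(B^{(H)})\neq\{0\}\}$. *)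

theory Defs
  imports
    "HOL-Computational_Algebra.Polynomial_Factorial"
    "HOL-Computational_Algebra.Group_Closure"
    "HOL-Library.Set_Algebras"
    "HOL-Library.FuncSet"
    "HOL-Library.Extended_Nat"
begin

section \<open>Rings, ideals, height\<close>

text \<open>
  Rings occur either as types or as subrings of a type. Ideals of a ring \<open>'a\<close> are its submodules
  when it is viewed as a module over itself.
\<close>

interpretation ring_module: module "(*) :: 'a::comm_ring_1 \<Rightarrow> 'a \<Rightarrow> 'a"
  by unfold_locales (simp_all add: algebra_simps)

abbreviation is_ideal :: "'a::comm_ring_1 set \<Rightarrow> bool"
  where "is_ideal \<equiv> module.subspace (*)"

abbreviation ideal_gen :: "'a::comm_ring_1 set \<Rightarrow> 'a set"
  where "ideal_gen \<equiv> module.span (*)"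

definition noetherian :: "'a::comm_ring_1 itself \<Rightarrow> bool"
  where "noetherian _ \<longleftrightarrow> (\<forall>I::'a set. is_ideal I \<longrightarrow> (\<exists>S. finite S \<and> I = ideal_gen S))"

definition prime_ideal :: "'a::comm_ring_1 set \<Rightarrow> bool"
  where "prime_ideal P \<longleftrightarrow>
    is_ideal P \<and> P \<noteq> UNIV \<and> (\<forall>a b. a * b \<in> P \<longrightarrow> a \<in> P \<or> b \<in> P)"

text \<open>Supremum of the lengths \<open>n\<close> of chains \<open>C 0 \<subset> C 1 \<subset> \<dots> \<subset> C n = P\<close> of prime ideals.\<close>

definition height :: "'a::comm_ring_1 set \<Rightarrow> enat"
  where "height P = Sup {enat n | n. \<exists>C :: nat \<Rightarrow> 'a set.
    (\<forall>i\<le>n. prime_ideal (C i)) \<and> (\<forall>i<n. C i \<subset> C (Suc i)) \<and> C n = P}"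

definition Spec1 :: "'a::comm_ring_1 set set"
  where "Spec1 = {P. prime_ideal P \<and> height P = 1}"

definition is_rat_algebra :: "'a::comm_ring_1 itself \<Rightarrow> bool"
  where "is_rat_algebra _ \<longleftrightarrow> (\<exists>f :: rat \<Rightarrow> 'a. f 1 = 1 \<and>
    (\<forall>x y. f (x + y) = f x + f y) \<and> (\<forall>x y. f (x * y) = f x * f y))"

text \<open>Every element of the field of fractions that is integral over the domain lies in it.\<close>

definition normal_domain :: "'a::idom itself \<Rightarrow> bool"
  where "normal_domain _ \<longleftrightarrow> (\<forall>x :: 'a fract.
    (\<exists>p :: 'a poly. lead_coeff p = 1 \<and> poly (fract_poly p) x = 0) \<longrightarrow> x \<in> range to_fract)"

definition is_subring :: "'a::comm_ring_1 set \<Rightarrow> bool"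
  where "is_subring A \<longleftrightarrow> 1 \<in> A \<and> (\<forall>x\<in>A. \<forall>y\<in>A. x - y \<in> A \<and> x * y \<in> A)"

definition is_ring_hom :: "'a::comm_ring_1 set \<Rightarrow> 'b::comm_ring_1 set \<Rightarrow> ('a \<Rightarrow> 'b) \<Rightarrow> bool"
  where "is_ring_hom A B \<phi> \<longleftrightarrow> \<phi> \<in> A \<rightarrow> B \<and> \<phi> 1 = 1 \<and>
    (\<forall>x\<in>A. \<forall>y\<in>A. \<phi> (x + y) = \<phi> x + \<phi> y \<and> \<phi> (x * y) = \<phi> x * \<phi> y)"


section \<open>Derivations\<close>

text \<open>
  Derivations of a subring \<open>A\<close> are extensional functions (arbitrary but fixed outside of \<open>A\<close>), so
  that equality of derivations is equality of maps \<open>A \<rightarrow> A\<close>; the zero derivation is \<open>\<lambda>x\<in>A. 0\<close>.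
\<close>

definition derivations :: "'a::comm_ring_1 set \<Rightarrow> ('a \<Rightarrow> 'a) set"
  where "derivations A = {D \<in> A \<rightarrow>\<^sub>E A. \<forall>x\<in>A. \<forall>y\<in>A.
    D (x + y) = D x + D y \<and> D (x * y) = D x * y + x * D y}"

definition EXT :: "'a::comm_ring_1 set \<Rightarrow> 'b::comm_ring_1 set \<Rightarrow> ('a \<Rightarrow> 'b) \<Rightarrow> bool"
  where "EXT A B \<phi> \<longleftrightarrow> is_subring A \<and> is_subring B \<and> is_ring_hom A B \<phi> \<and>
    (\<forall>\<delta>\<in>derivations A. \<exists>!D. D \<in> derivations B \<and> (\<forall>a\<in>A. D (\<phi> a) = \<phi> (\<delta> a)))"

definition locally_nilpotent :: "'a::comm_ring_1 set \<Rightarrow> ('a \<Rightarrow> 'a) \<Rightarrow> bool"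
  where "locally_nilpotent A D \<longleftrightarrow> (\<forall>b\<in>A. \<exists>n>0. (D ^^ n) b = 0)"


section \<open>Abelian groups\<close>

definition is_subgroup :: "'g::ab_group_add set \<Rightarrow> bool"
  where "is_subgroup H \<longleftrightarrow> 0 \<in> H \<and> (\<forall>x\<in>H. \<forall>y\<in>H. x - y \<in> H)"

definition fin_gen_group :: "'g::ab_group_add itself \<Rightarrow> bool"
  where "fin_gen_group _ \<longleftrightarrow> (\<exists>S::'g set. finite S \<and> group_closure S = UNIV)"

text \<open>\<open>K/N\<close> is a torsion group; the sum is the multiple \<open>n \<cdot> x\<close>, and \<open>n \<cdot> (x + N) = N\<close> in \<open>K/N\<close>
  means \<open>n \<cdot> x \<in> N\<close>.\<close>

definition torsion_quotient :: "'g::ab_group_add set \<Rightarrow> 'g set \<Rightarrow> bool"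
  where "torsion_quotient K N \<longleftrightarrow> (\<forall>x\<in>K. \<exists>n>0. (\<Sum>_<(n::nat). x) \<in> N)"


section \<open>Graded rings\<close>

definition grading :: "('g::ab_group_add \<Rightarrow> 'b::comm_ring_1 set) \<Rightarrow> bool"
  where "grading B \<longleftrightarrow>
    (\<forall>i. is_subgroup (B i)) \<and>
    (\<forall>i j. \<forall>x\<in>B i. \<forall>y\<in>B j. x * y \<in> B (i + j)) \<and>
    (\<forall>b. \<exists>!f. (\<forall>i. f i \<in> B i) \<and> finite {i. f i \<noteq> 0} \<and> b = (\<Sum>i | f i \<noteq> 0. f i))"

text \<open>\<open>B\<^sup>(\<^sup>H\<^sup>)\<close>, as a subset of the ring that \<open>B\<close> grades.\<close>

definition part :: "('g::ab_group_add \<Rightarrow> 'b::comm_ring_1 set) \<Rightarrow> 'g set \<Rightarrow> 'b set"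
  where "part B H = {\<Sum>i\<in>F. f i | F f. finite F \<and> F \<subseteq> H \<and> (\<forall>i\<in>F. f i \<in> B i)}"

definition GG :: "('g::ab_group_add \<Rightarrow> 'b::comm_ring_1 set) \<Rightarrow> 'g set"
  where "GG B = group_closure {i. B i \<noteq> {0}}"

definition TT :: "('g::ab_group_add \<Rightarrow> 'b::comm_ring_1 set) \<Rightarrow> 'g set set"
  where "TT B = {H. is_subgroup H \<and> torsion_quotient (GG B) (H \<inter> GG B)}"

definition MM :: "('g::ab_group_add \<Rightarrow> 'b::comm_ring_1 set) \<Rightarrow> 'b set \<Rightarrow> 'g set"
  where "MM B P = {i. \<not> B i \<subseteq> P}"

definition Mbar :: "('g::ab_group_add \<Rightarrow> 'b::comm_ring_1 set) \<Rightarrow> 'b set \<Rightarrow> 'g set"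
  where "Mbar B P = group_closure (MM B P)"

definition Gbar :: "('g::ab_group_add \<Rightarrow> 'b::comm_ring_1 set) \<Rightarrow> 'g set"
  where "Gbar B = (if (Spec1 :: 'b set set) = {} then GG B else (\<Inter>P\<in>Spec1. Mbar B P))"

text \<open>
  \<open>HLND B H\<close> stands for \<open>HLND(B\<^sup>(\<^sup>H\<^sup>))\<close>, where \<open>B\<^sup>(\<^sup>H\<^sup>)\<close> is graded by \<open>H\<close>; in particular the degree of
  a homogeneous derivation is taken in \<open>H\<close>.
\<close>

definition HLND :: "('g::ab_group_add \<Rightarrow> 'b::comm_ring_1 set) \<Rightarrow> 'g set \<Rightarrow> ('b \<Rightarrow> 'b) set"
  where "HLND B H = {D \<in> derivations (part B H). locally_nilpotent (part B H) D \<and>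
    (\<exists>d\<in>H. \<forall>i\<in>H. D ` B i \<subseteq> B (i + d))}"

definition XX :: "('g::ab_group_add \<Rightarrow> 'b::comm_ring_1 set) \<Rightarrow> 'g set set"
  where "XX B = {H \<in> TT B. HLND B H \<noteq> {\<lambda>x\<in>part B H. 0}}"

end

theory Submission
  imports Defs
begin

text \<open>
  A derivation \<open>\<delta>\<close> of \<open>A = part B H\<close> is extended to homogeneous elements \<open>b\<close> of \<open>B\<close>, which have powers
  \<open>b ^ n\<close> in \<open>A\<close>, by \<open>D b = \<delta> (b ^ n) / (n * b ^ (n - 1))\<close> in the field of fractions. For a prime \<open>P\<close> of
  height one, \<open>D s\<close> lies in the localization at \<open>P\<close> whenever \<open>s \<notin> P\<close>. If the degree of \<open>b\<close> lies in
  \<open>H + Mbar B P\<close>, then \<open>b * w \<in> A\<close> for some homogeneous \<open>w \<notin> P\<close>, and Leibniz' rule shows that \<open>D b\<close> lies in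
  this localization too. A noetherian normal domain is the intersection of its localizations at
  primes of height one, so \<open>D\<close> maps \<open>part B (H + Gbar B)\<close> into \<open>B\<close>.

  If moreover \<open>\<delta>\<close> is homogeneous and locally nilpotent, the number of times that \<open>b ^ n \<in> A\<close> can be
  derived before it vanishes is additive in products, and \<open>n * b ^ (n - 1) * D b = \<delta> (b ^ n)\<close> shows that
  it drops from \<open>b ^ n\<close> to \<open>(D b) ^ n\<close>. So \<open>D\<close> is locally nilpotent.
\<close>

text \<open>For the scalar action of a ring on itself this rule undoes associativity.\<close>
declare ring_module.scale_scale [simp del]

section \<open>Noetherian normal domains\<close>

text \<open>The ideal generated by all terms is finitely generated, and each of its generators
  involves only finitely many terms; so an initial segment generates it already and the next term
  brings nothing new. This is the form of the ascending chain condition used below.\<close>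

lemma noetherian_sequence:
  fixes v :: "nat \<Rightarrow> 'a::comm_ring_1"
  assumes "noetherian TYPE('a)"
  obtains n where "v n \<in> ideal_gen (v ` {..<n})"
proof -
  obtain S where S: "finite S" "ideal_gen (range v) = ideal_gen S"
    using assms unfolding noetherian_def by (metis ring_module.subspace_span)
  have "\<exists>n. s \<in> ideal_gen (v ` {..<n})" if "s \<in> ideal_gen (range v)" for s
    using that
  proof (induction rule: ring_module.span_induct_alt)
    case base
    show ?case by (auto intro: ring_module.span_zero)
  next
    case (step c x y)
    then obtain m n where mn: "x = v m" "y \<in> ideal_gen (v ` {..<n})"
      by blast
    have "x \<in> ideal_gen (v ` {..<max (Suc m) n})"
      by (rule ring_module.span_base) (auto simp: mn)
    moreover have "ideal_gen (v ` {..<n}) \<subseteq> ideal_gen (v ` {..<max (Suc m) n})"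
      by (intro ring_module.span_mono) auto
    ultimately show ?case
      using mn by (meson in_mono ring_module.span_add ring_module.span_scale)
  qed
  then have "\<exists>N. \<forall>s\<in>S. s \<in> ideal_gen (v ` {..<N s})"
    using S(2) ring_module.span_superset by (intro bchoice) blast
  then obtain N where N: "\<And>s. s \<in> S \<Longrightarrow> s \<in> ideal_gen (v ` {..<N s})"
    by blast
  \<comment> \<open>Inserting 0 keeps \<open>Max\<close> meaningful when \<open>S\<close> is
    empty.\<close>
  define n where "n = Max (insert 0 (N ` S))"
  have "N s \<le> n" if "s \<in> S" for s
    unfolding n_def using S(1) that by simp
  then have "S \<subseteq> ideal_gen (v ` {..<n})"
    using N by (meson image_mono in_mono lessThan_subset_iff ring_module.span_mono subsetI)
  then have "ideal_gen S \<subseteq> ideal_gen (v ` {..<n})"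
    by (intro ring_module.span_minimal) auto
  moreover have "v n \<in> ideal_gen S"
    using S(2) by (metis rangeI ring_module.span_base)
  ultimately show thesis
    by (intro that) blast
qed

text \<open>The coefficients are indexed by positions and not by elements of the image, since
  \<open>v\<close> need not be injective.\<close>

lemma ideal_gen_image_lessThan:
  fixes v :: "nat \<Rightarrow> 'a::comm_ring_1"
  assumes "x \<in> ideal_gen (v ` {..<n})"
  obtains c where "x = (\<Sum>i<n. c i * v i)"
proof -
  have "\<exists>c. x = (\<Sum>i<n. c i * v i)"
    using assms
  proof (induction rule: ring_module.span_induct_alt)
    case base
    show ?case by (intro exI[of _ "\<lambda>_. 0"]) simp
  next
    case (step a y z)
    then obtain m c where mc: "m < n" "y = v m" "z = (\<Sum>i<n. c i * v i)"
      by blast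
    have "a * v m = (\<Sum>i<n. (if i = m then a else 0) * v i)"
      using mc(1) by (subst sum.remove[of _ m]) auto
    then have "a * y + z = (\<Sum>i<n. ((if i = m then a else 0) + c i) * v i)"
      by (simp add: mc distrib_right sum.distrib)
    then show ?case
      by (intro exI[of _ "\<lambda>i. (if i = m then a else 0) + c i"])
  qed
  then show thesis using that by blast
qed

text \<open>Without a maximal member, choice yields a strictly increasing chain of ideals; a
  sequence picking a new element at each stage contradicts
  \<open>noetherian_sequence\<close>.\<close>

lemma noetherian_maximal_ideal:
  fixes F :: "'a::comm_ring_1 set set"
  assumes "noetherian TYPE('a)" and "F \<noteq> {}" and "\<And>I. I \<in> F \<Longrightarrow> is_ideal I"
  obtains I where "I \<in> F" and "\<And>J. J \<in> F \<Longrightarrow> I \<subseteq> J \<Longrightarrow> J = I"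
proof (rule ccontr)
  assume "\<not> thesis"
  then have "\<forall>I\<in>F. \<exists>J\<in>F. I \<subset> J"
    using that by blast
  then obtain next_ideal where nxt: "\<And>I. I \<in> F \<Longrightarrow> next_ideal I \<in> F \<and> I \<subset> next_ideal I"
    by metis
  obtain I0 where "I0 \<in> F" using assms(2) by blast
  define I where "I n = (next_ideal ^^ n) I0" for n
  have IF: "I n \<in> F" for n
    by (induction n) (auto simp: I_def \<open>I0 \<in> F\<close> nxt)
  have IS: "I n \<subset> I (Suc n)" for n
    using nxt[OF IF[of n]] by (simp add: I_def)
  have mono: "I m \<subseteq> I n" if "m \<le> n" for m n
    using lift_Suc_mono_le[of I, OF _ that] IS by blast
  have "\<exists>v. v \<in> I (Suc n) - I n" for n
    using IS[of n] by blast
  then obtain v where v: "\<And>n. v n \<in> I (Suc n) - I n"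
    by metis
  obtain n where "v n \<in> ideal_gen (v ` {..<n})"
    using noetherian_sequence[OF assms(1)] .
  moreover have "v ` {..<n} \<subseteq> I n"
  proof (rule image_subsetI)
    fix m assume "m \<in> {..<n}"
    then show "v m \<in> I n" using v[of m] mono[of "Suc m" n] by auto
  qed
  then have "ideal_gen (v ` {..<n}) \<subseteq> I n"
    by (intro ring_module.span_minimal assms(3) IF)
  ultimately show False using v by blast
qed

section \<open>Prime ideals of height one in a domain\<close>

lemma zero_prime_ideal: "prime_ideal {0 :: 'a::idom}"
proof -
  have "(1::'a) \<notin> {0}" by simp
  then have "{0 :: 'a} \<noteq> UNIV" by blast
  then show ?thesis by (simp add: prime_ideal_def)
qed

text \<open>In a domain \<open>{0}\<close> is prime, which gives a chain of length one. In a longer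
  chain the prime just below \<open>P\<close> is \<open>{0}\<close> by hypothesis, and nothing fits
  properly below that.\<close>

lemma height_eq_1I:
  fixes P :: "'a::idom set"
  assumes "prime_ideal P" and "P \<noteq> {0}"
    and "\<And>Q. prime_ideal Q \<Longrightarrow> Q \<subset> P \<Longrightarrow> Q = {0}"
  shows "height P = 1"
  unfolding height_def
proof (rule antisym)
  have zero: "0 \<in> Q" if "prime_ideal Q" for Q :: "'a set"
    using that by (auto simp: prime_ideal_def intro: ring_module.subspace_0)
  show "Sup {enat n | n. \<exists>C :: nat \<Rightarrow> 'a set.
    (\<forall>i\<le>n. prime_ideal (C i)) \<and> (\<forall>i<n. C i \<subset> C (Suc i)) \<and> C n = P} \<le> 1"
  proof (rule Sup_least, clarify)
    fix n and C :: "nat \<Rightarrow> 'a set"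
    assume C: "\<forall>i\<le>n. prime_ideal (C i)" "\<forall>i<n. C i \<subset> C (Suc i)" "P = C n"
    show "enat n \<le> 1"
    proof (rule ccontr)
      assume "\<not> enat n \<le> 1"
      then obtain m where m: "n = Suc (Suc m)"
        by (metis One_nat_def enat_ord_simps(1) le_SucI le_refl not0_implies_Suc one_enat_def zero_le)
      then have "C (Suc m) = {0}" using C assms(3) by simp
      moreover have "C m \<subset> C (Suc m)" "0 \<in> C m" using C m zero by auto
      ultimately show False by auto
    qed
  qed
  have "\<exists>C :: nat \<Rightarrow> 'a set.
    (\<forall>i\<le>1. prime_ideal (C i)) \<and> (\<forall>i<1. C i \<subset> C (Suc i)) \<and> C 1 = P"
    using assms(1,2) zero[OF assms(1)] zero_prime_ideal
    by (intro exI[of _ "\<lambda>i. if i = 0 then {0} else P"]) auto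
  then show "1 \<le> Sup {enat n | n. \<exists>C :: nat \<Rightarrow> 'a set.
    (\<forall>i\<le>n. prime_ideal (C i)) \<and> (\<forall>i<n. C i \<subset> C (Suc i)) \<and> C n = P}"
    by (intro Sup_upper) (auto simp: one_enat_def)
qed

section \<open>A noetherian normal domain as the intersection of its localizations at height
  one\<close>

lemma to_fract_power [simp]: "to_fract (x ^ n) = to_fract x ^ n"
  by (induction n) (simp_all only: power_0 power_Suc to_fract_1 to_fract_mult)

text \<open>Almost integral elements are integral over a noetherian domain: some
  \<open>c * x ^ n\<close> is a combination of the earlier ones, and cancelling \<open>c\<close>
  leaves a monic equation for \<open>x\<close>.\<close>

lemma noetherian_normal_bounded_powers:
  fixes x :: "'a::idom fract"
  assumes "noetherian TYPE('a)" and "normal_domain TYPE('a)"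
    and "c \<noteq> 0" and "\<And>n. to_fract c * x ^ n \<in> range to_fract"
  shows "x \<in> range to_fract"
proof -
  have "\<exists>v. to_fract v = to_fract c * x ^ n" for n
    by (rule rangeE[OF assms(4)[of n]]) (rule exI, erule sym)
  then have "\<exists>v. \<forall>n. to_fract (v n) = to_fract c * x ^ n"
    by (intro choice allI)
  then obtain v where v: "\<And>n. to_fract (v n) = to_fract c * x ^ n"
    by blast
  obtain n where "v n \<in> ideal_gen (v ` {..<n})"
    using noetherian_sequence[OF assms(1)] .
  then obtain a where a: "v n = (\<Sum>i<n. a i * v i)"
    by (rule ideal_gen_image_lessThan)
  have "to_fract c * x ^ n = (\<Sum>i<n. to_fract (a i) * (to_fract c * x ^ i))"
    using arg_cong[OF a, of to_fract] by (simp add: v)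
  also have "\<dots> = to_fract c * (\<Sum>i<n. to_fract (a i) * x ^ i)"
    by (simp only: sum_distrib_left mult.left_commute)
  finally have x: "x ^ n = (\<Sum>i<n. to_fract (a i) * x ^ i)"
    using assms(3) by simp
  define p where "p = monom 1 n - (\<Sum>i<n. monom (a i) i)"
  have coeff: "coeff p i = (if i = n then 1 else 0) - (\<Sum>j<n. if j = i then a j else 0)" for i
    unfolding p_def coeff_diff coeff_sum coeff_monom by (auto intro!: sum.cong)
  have deg: "degree p \<le> n"
    by (intro degree_le) (simp add: coeff)
  have "coeff p n = 1"
    by (simp add: coeff)
  then have "lead_coeff p = 1"
    using deg by (metis le_antisym le_degree one_neq_zero)
  moreover have "fract_poly (sum f I) = (\<Sum>i\<in>I. fract_poly (f i))" for I :: "nat set" and f :: "nat \<Rightarrow> 'a poly"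
    by (induction I rule: infinite_finite_induct) auto
  then have "poly (fract_poly p) x = 0"
    by (simp add: p_def map_poly_monom poly_sum poly_monom x)
  ultimately show ?thesis
    using assms(2) unfolding normal_domain_def by blast
qed

lemma range_to_fract_add: "x \<in> range to_fract \<Longrightarrow> y \<in> range to_fract \<Longrightarrow> x + y \<in> range to_fract"
  by (auto simp flip: to_fract_add)

lemma range_to_fract_mult: "x \<in> range to_fract \<Longrightarrow> y \<in> range to_fract \<Longrightarrow> x * y \<in> range to_fract"
  by (auto simp flip: to_fract_mult)

text \<open>The annihilator of the class of \<open>x\<close> in the fraction field modulo the ring.
  Its maximal proper instances are therefore prime, as for associated primes of a module.\<close>

definition denominators :: "'a::idom fract \<Rightarrow> 'a set"
  where "denominators x = {c. to_fract c * x \<in> range to_fract}"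

lemma denominators_ideal: "is_ideal (denominators x)"
proof (rule ring_module.subspaceI)
  show "0 \<in> denominators x"
    by (simp add: denominators_def rev_image_eqI[of 0])
next
  fix a b assume "a \<in> denominators x" "b \<in> denominators x"
  then show "a + b \<in> denominators x"
    by (simp only: denominators_def mem_Collect_eq to_fract_add distrib_right range_to_fract_add)
next
  fix c a assume "a \<in> denominators x"
  then show "c * a \<in> denominators x"
    by (simp only: denominators_def mem_Collect_eq to_fract_mult mult.assoc range_to_fract_mult rangeI)
qed

lemma denominators_subset_mult: "denominators x \<subseteq> denominators (to_fract s * x)"
proof
  fix c assume "c \<in> denominators x"
  then have "to_fract s * (to_fract c * x) \<in> range to_fract"
    by (auto simp only: denominators_def mem_Collect_eq intro: range_to_fract_mult)
  then show "c \<in> denominators (to_fract s * x)"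
    by (simp only: denominators_def mem_Collect_eq mult.left_commute)
qed

text \<open>
  A maximal proper ideal of the form \<open>denominators y\<close> is a prime \<open>P\<close> of height one: as \<open>y\<close> is not
  integral, \<open>u = p * y\<close> lies outside of \<open>P\<close> for some \<open>p \<in> P\<close>, so that \<open>p\<close> generates \<open>P\<close> locally.
\<close>
lemma maximal_denominators_Spec1:
  fixes y :: "'a::idom fract"
  assumes "noetherian TYPE('a)" and "normal_domain TYPE('a)" and y: "y \<notin> range to_fract"
    and max: "\<And>r. to_fract r * y \<notin> range to_fract \<Longrightarrow> denominators (to_fract r * y) = denominators y"
  shows "denominators y \<in> Spec1"
proof -
  define P where "P = denominators y"
  have ideal: "is_ideal P"
    by (simp add: P_def denominators_ideal)
  have prime: "prime_ideal P"
    unfolding prime_ideal_def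
  proof (intro conjI ideal allI impI)
    have "1 \<notin> P" using y by (auto simp: P_def denominators_def)
    then show "P \<noteq> UNIV" by blast
  next
    fix a b assume ab: "a * b \<in> P"
    show "a \<in> P \<or> b \<in> P"
    proof (cases "a \<in> P")
      case False
      then have "to_fract a * y \<notin> range to_fract"
        by (simp add: P_def denominators_def)
      then have "P = denominators (to_fract a * y)"
        unfolding P_def by (rule max[symmetric])
      moreover have "to_fract (a * b) * y = to_fract b * (to_fract a * y)"
        by (simp only: to_fract_mult mult_ac)
      with ab have "b \<in> denominators (to_fract a * y)"
        by (simp only: P_def denominators_def mem_Collect_eq)
      ultimately show ?thesis by simp
    qed auto
  qed
  obtain p' c where y_eq: "y = Fract p' c" "c \<noteq> 0"
    by (cases y)
  then have c: "c \<in> P"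
    by (simp add: P_def denominators_def Fract_conv_to_fract)
  \<comment> \<open>Otherwise multiplication by \<open>y\<close> maps \<open>P\<close> into itself,
    all \<open>c * y ^ n\<close> stay in the ring, and \<open>y\<close> lies in the ring by
    normality.\<close>
  have "\<exists>p\<in>P. \<exists>u. u \<notin> P \<and> to_fract p * y = to_fract u"
  proof (rule ccontr)
    assume *: "\<not> ?thesis"
    have "\<exists>v\<in>P. to_fract v = to_fract c * y ^ n" for n
    proof (induction n)
      case 0
      then show ?case using c by auto
    next
      case (Suc n)
      then obtain v where v: "v \<in> P" "to_fract v = to_fract c * y ^ n"
        by blast
      from v(1) obtain w where w: "to_fract v * y = to_fract w"
        by (auto simp: P_def denominators_def)
      then have "w \<in> P" using * v(1) by blast
      then show ?case using v(2) w by (metis mult.assoc power_Suc2)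
    qed
    then have "to_fract c * y ^ n \<in> range to_fract" for n
      by (metis rangeI)
    then have "y \<in> range to_fract"
      by (rule noetherian_normal_bounded_powers[OF assms(1,2) y_eq(2)])
    with y show False by blast
  qed
  then obtain p u where pu: "p \<in> P" "u \<notin> P" "to_fract p * y = to_fract u"
    by blast
  have "p \<noteq> 0" using pu ring_module.subspace_0[OF ideal] by auto
  \<comment> \<open>\<open>u\<close> becomes a unit in the localization at \<open>P\<close>; up to
    this unit, \<open>p\<close> divides every element of \<open>P\<close>.\<close>
  have div: "\<exists>w. u * q = p * w" if q: "q \<in> P" for q
  proof -
    obtain w where w: "to_fract q * y = to_fract w"
      using q by (auto simp: P_def denominators_def)
    have "to_fract (u * q) = to_fract (p * w)"
      unfolding to_fract_mult pu(3)[symmetric] w[symmetric] by (simp only: mult_ac)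
    then show ?thesis unfolding to_fract_eq_iff by blast
  qed
  have "Q = {0}" if Q: "prime_ideal Q" "Q \<subset> P" for Q
  proof (rule ccontr)
    assume "Q \<noteq> {0}"
    have idQ: "is_ideal Q" and primeQ: "\<And>a b. a * b \<in> Q \<Longrightarrow> a \<in> Q \<or> b \<in> Q"
      using Q(1) by (auto simp: prime_ideal_def)
    have "u \<notin> Q" using Q(2) pu(2) by blast
    have "p \<notin> Q"
    proof
      assume "p \<in> Q"
      have "q \<in> Q" if "q \<in> P" for q
      proof -
        obtain w where "u * q = p * w" using div[OF \<open>q \<in> P\<close>] by blast
        then have "u * q \<in> Q"
          using ring_module.subspace_scale[OF idQ \<open>p \<in> Q\<close>, of w] by (simp add: mult.commute)
        then show ?thesis using primeQ \<open>u \<notin> Q\<close> by blast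
      qed
      then show False using Q(2) by blast
    qed
    obtain q where q: "q \<in> Q" "q \<noteq> 0"
      using \<open>Q \<noteq> {0}\<close> ring_module.subspace_0[OF idQ] by blast
    \<comment> \<open>As \<open>p\<close> lies outside of \<open>Q\<close>, the quotients remain in
      \<open>Q\<close> and can be divided again. So, up to powers of \<open>u\<close>, every power
      of \<open>p\<close> divides \<open>q\<close>.\<close>
    have "\<exists>w\<in>Q. u ^ n * q = p ^ n * w" for n
    proof (induction n)
      case 0
      then show ?case using q(1) by simp
    next
      case (Suc n)
      then obtain w where w: "w \<in> Q" "u ^ n * q = p ^ n * w" by blast
      then obtain w' where w': "u * w = p * w'" using div Q(2) by blast
      then have "p * w' \<in> Q"
        using ring_module.subspace_scale[OF idQ w(1), of u] by simp
      then have "w' \<in> Q" using primeQ \<open>p \<notin> Q\<close> by blast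
      moreover have "u ^ Suc n * q = p ^ Suc n * w'"
        by (simp only: power_Suc mult.assoc w(2) mult.left_commute[of u "p ^ n"] w' mult.left_commute[of p "p ^ n"])
      ultimately show ?case by blast
    qed
    then obtain w where w: "\<And>n. u ^ n * q = p ^ n * w n" by metis
    \<comment> \<open>An instance of Krull's intersection argument: a relation expressing
      \<open>w n\<close> by earlier quotients, multiplied by \<open>p ^ n\<close> and divided by
      \<open>q\<close>, exhibits \<open>u ^ n\<close> as a multiple of \<open>p\<close>.\<close>
    obtain n where "w n \<in> ideal_gen (w ` {..<n})"
      using noetherian_sequence[OF assms(1)] .
    then obtain a where a: "w n = (\<Sum>i<n. a i * w i)"
      by (rule ideal_gen_image_lessThan)
    have "u ^ n * q = p ^ n * (\<Sum>i<n. a i * w i)"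
      by (simp only: w a)
    also have "\<dots> = (\<Sum>i<n. a i * (p ^ n * w i))"
      by (simp only: sum_distrib_left mult.left_commute)
    also have "\<dots> = (\<Sum>i<n. a i * (p ^ (n - i) * u ^ i * q))"
    proof (intro sum.cong refl)
      fix i assume "i \<in> {..<n}"
      then have "p ^ n = p ^ (n - i) * p ^ i"
        by (simp flip: power_add)
      then show "a i * (p ^ n * w i) = a i * (p ^ (n - i) * u ^ i * q)"
        by (simp only: mult.assoc w)
    qed
    also have "\<dots> = (\<Sum>i<n. a i * p ^ (n - i) * u ^ i) * q"
      by (simp only: sum_distrib_right mult.assoc)
    finally have "u ^ n = (\<Sum>i<n. a i * p ^ (n - i) * u ^ i)"
      using q(2) by simp
    moreover have "(\<Sum>i<n. a i * p ^ (n - i) * u ^ i) \<in> P"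
    proof (intro ring_module.subspace_sum[OF ideal])
      fix i assume "i \<in> {..<n}"
      then have "p ^ (n - i) = p ^ (n - i - 1) * p"
        by (metis Suc_pred' lessThan_iff power_Suc2 zero_less_diff diff_Suc_eq_diff_pred diff_Suc_1')
      then have "a i * p ^ (n - i) * u ^ i = (a i * p ^ (n - i - 1) * u ^ i) * p"
        by (simp only: mult_ac)
      then show "a i * p ^ (n - i) * u ^ i \<in> P"
        using ring_module.subspace_scale[OF ideal pu(1)] by metis
    qed
    ultimately have "u ^ n \<in> P" by simp
    then show False
    proof (induction n)
      case 0
      then show ?case using y by (auto simp: P_def denominators_def)
    next
      case (Suc n)
      then show ?case using prime pu(2) by (auto simp: prime_ideal_def)
    qed
  qed
  then have "height P = 1"
    using c y_eq(2) by (intro height_eq_1I prime) auto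
  then show ?thesis
    using prime by (simp add: Spec1_def flip: P_def)
qed

text \<open>If \<open>x\<close> is not in the ring, a maximal ideal among the denominators of those
  multiples of \<open>x\<close> that are not in the ring either is a prime \<open>P\<close> of
  height one. A denominator of \<open>x\<close> outside of \<open>P\<close> is also one of the
  multiple, hence in \<open>P\<close>.\<close>

lemma noetherian_normal_Inter_Spec1:
  fixes x :: "'a::idom fract"
  assumes "noetherian TYPE('a)" and "normal_domain TYPE('a)"
    and loc: "\<And>P. P \<in> Spec1 \<Longrightarrow> \<exists>u. u \<notin> P \<and> to_fract u * x \<in> range to_fract"
  shows "x \<in> range to_fract"
proof (rule ccontr)
  assume x: "x \<notin> range to_fract"
  define F where "F = {denominators (to_fract r * x) | r. to_fract r * x \<notin> range to_fract}"
  have F_I: "denominators (to_fract r * x) \<in> F" if "to_fract r * x \<notin> range to_fract" for r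
    unfolding F_def by (rule CollectI, rule exI[of _ r], rule conjI[OF refl that])
  have "denominators (to_fract 1 * x) \<in> F"
    using x by (intro F_I) (simp only: to_fract_1 mult_1 not_False_eq_True)
  then have nonempty: "F \<noteq> {}" by blast
  have ideals: "is_ideal I" if "I \<in> F" for I
    using that by (auto simp: F_def denominators_ideal)
  obtain P where P: "P \<in> F" and max: "\<And>J. J \<in> F \<Longrightarrow> P \<subseteq> J \<Longrightarrow> J = P"
    using noetherian_maximal_ideal[OF assms(1) nonempty ideals] by blast
  from P obtain r where r: "P = denominators (to_fract r * x)" "to_fract r * x \<notin> range to_fract"
    by (auto simp: F_def)
  have "P \<in> Spec1"
    unfolding r(1)
  proof (rule maximal_denominators_Spec1[OF assms(1,2) r(2)])
    fix s assume s: "to_fract s * (to_fract r * x) \<notin> range to_fract"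
    then have "denominators (to_fract s * (to_fract r * x)) \<in> F"
      using F_I[of "s * r"] by (simp only: to_fract_mult mult.assoc simp_thms)
    moreover have "P \<subseteq> denominators (to_fract s * (to_fract r * x))"
      unfolding r(1) by (rule denominators_subset_mult)
    ultimately show "denominators (to_fract s * (to_fract r * x)) = denominators (to_fract r * x)"
      using max r(1) by blast
  qed
  then obtain u where "u \<notin> P" "to_fract u * x \<in> range to_fract"
    using loc by blast
  then have "u \<in> denominators x"
    by (simp add: denominators_def)
  then show False
    using denominators_subset_mult[of x r] r(1) \<open>u \<notin> P\<close> by blast
qed

section \<open>Derivations\<close>

lemma subring_zero: "is_subring A \<Longrightarrow> 0 \<in> A"
  unfolding is_subring_def by (metis diff_self)

lemma subring_one: "is_subring A \<Longrightarrow> 1 \<in> A"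
  by (simp add: is_subring_def)

lemma subring_mult: "is_subring A \<Longrightarrow> x \<in> A \<Longrightarrow> y \<in> A \<Longrightarrow> x * y \<in> A"
  by (simp add: is_subring_def)

lemma subring_diff: "is_subring A \<Longrightarrow> x \<in> A \<Longrightarrow> y \<in> A \<Longrightarrow> x - y \<in> A"
  by (simp add: is_subring_def)

lemma subring_add: "is_subring A \<Longrightarrow> x \<in> A \<Longrightarrow> y \<in> A \<Longrightarrow> x + y \<in> A"
  using subring_diff[of A x "0 - y"] subring_diff[of A 0 y] subring_zero[of A] by simp

lemma subring_power: "is_subring A \<Longrightarrow> x \<in> A \<Longrightarrow> x ^ n \<in> A"
  by (induction n) (auto intro: subring_one subring_mult)

lemma derivation_closed: "D \<in> derivations A \<Longrightarrow> x \<in> A \<Longrightarrow> D x \<in> A"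
  by (auto simp: derivations_def)

lemma derivation_add: "D \<in> derivations A \<Longrightarrow> x \<in> A \<Longrightarrow> y \<in> A \<Longrightarrow> D (x + y) = D x + D y"
  by (auto simp: derivations_def)

lemma derivation_mult: "D \<in> derivations A \<Longrightarrow> x \<in> A \<Longrightarrow> y \<in> A \<Longrightarrow> D (x * y) = D x * y + x * D y"
  by (auto simp: derivations_def)

lemma derivation_zero:
  assumes "is_subring A" "D \<in> derivations A"
  shows "D 0 = 0"
  using derivation_add[OF assms(2), of 0 0] subring_zero[OF assms(1)] by simp

lemma derivation_power:
  assumes "is_subring A" "D \<in> derivations A" "x \<in> A"
  shows "D (x ^ Suc n) = of_nat (Suc n) * x ^ n * D x"
proof (induction n)
  case (Suc n)
  have "D (x ^ Suc (Suc n)) = D x * x ^ Suc n + x * D (x ^ Suc n)"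
    unfolding power_Suc[of x "Suc n"] using assms by (intro derivation_mult subring_power)
  then show ?case
    unfolding Suc by (simp add: algebra_simps)
qed simp

lemma derivation_sum:
  assumes "is_subring A" "D \<in> derivations A" "finite F" "\<And>i. i \<in> F \<Longrightarrow> f i \<in> A"
  shows "(\<Sum>i\<in>F. f i) \<in> A \<and> D (\<Sum>i\<in>F. f i) = (\<Sum>i\<in>F. D (f i))"
  using assms(3,4)
  by (induction F rule: finite_induct)
    (auto simp: derivation_zero[OF assms(1,2)] derivation_add[OF assms(2)] subring_zero[OF assms(1)]
      subring_add[OF assms(1)])

lemma derivation_funpow_closed:
  "D \<in> derivations A \<Longrightarrow> x \<in> A \<Longrightarrow> (D ^^ n) x \<in> A"
  by (induction n) (auto intro: derivation_closed)

lemma derivation_funpow_zero: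
  "is_subring A \<Longrightarrow> D \<in> derivations A \<Longrightarrow> (D ^^ n) 0 = 0"
  by (induction n) (auto simp: derivation_zero)

lemma derivation_funpow_add:
  assumes "is_subring A" "D \<in> derivations A" "x \<in> A" "y \<in> A"
  shows "(D ^^ n) (x + y) = (D ^^ n) x + (D ^^ n) y"
  by (induction n) (auto simp: derivation_add[OF assms(2)] derivation_funpow_closed assms)

lemma rat_algebra_of_nat_unit:
  assumes "is_rat_algebra TYPE('a::comm_ring_1)" and "0 < n"
  obtains u :: "'a::comm_ring_1" where "u * of_nat n = 1"
proof -
  obtain f :: "rat \<Rightarrow> 'a" where f: "f 1 = 1" "\<And>x y. f (x + y) = f x + f y"
    "\<And>x y. f (x * y) = f x * f y"
    using assms(1) unfolding is_rat_algebra_def by blast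
  have "f 0 = 0" using f(2)[of 0 0] by simp
  then have "f (of_nat n) = of_nat n" for n
    by (induction n) (simp_all add: f)
  then have "f (1 / of_nat n) * of_nat n = 1"
    using f(3)[of "1 / of_nat n" "of_nat n"] f(1) assms(2) by simp
  then show thesis by (rule that)
qed

subsection \<open>Derivatives of roots\<close>

text \<open>\<open>\<iota>\<close> embeds the domain in a field, later by \<open>to_fract\<close>.
  Derivatives of roots live in this field until they are shown to lie in the ring.\<close>

locale root_derivation =
  fixes A :: "'b::idom set" and \<delta> :: "'b \<Rightarrow> 'b" and \<iota> :: "'b \<Rightarrow> 'k::field"
  assumes subring: "is_subring A" and derivation: "\<delta> \<in> derivations A"
    and char_0: "0 < n \<Longrightarrow> (of_nat n :: 'b) \<noteq> 0"
    and emb_1 [simp]: "\<iota> 1 = 1"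
    and emb_add [simp]: "\<iota> (x + y) = \<iota> x + \<iota> y"
    and emb_mult [simp]: "\<iota> (x * y) = \<iota> x * \<iota> y"
    and emb_eq_0_iff [simp]: "\<iota> x = 0 \<longleftrightarrow> x = 0"
begin

lemma emb_0 [simp]: "\<iota> 0 = 0"
  by simp

lemma emb_power [simp]: "\<iota> (x ^ n) = \<iota> x ^ n"
  by (induction n) auto

lemma emb_of_nat [simp]: "\<iota> (of_nat n) = of_nat n"
  by (induction n) auto

lemma of_nat_neq_0: "0 < n \<Longrightarrow> (of_nat n :: 'k) \<noteq> 0"
  using char_0 emb_of_nat emb_eq_0_iff by metis

text \<open>The exponent is arbitrary, and \<open>deriv_root_eq\<close> shows that it does not
  matter. At 0 the quotient is 0, in accordance with \<open>\<delta> 0 = 0\<close>.\<close>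

definition deriv_root :: "'b \<Rightarrow> 'k"
  where "deriv_root b = (let n = (SOME n. 0 < n \<and> b ^ n \<in> A) in
    \<iota> (\<delta> (b ^ n)) / (of_nat n * \<iota> b ^ (n - 1)))"

text \<open>Two exponents \<open>n\<close> and \<open>m\<close> are compared by deriving
  \<open>b ^ (n * m)\<close> both as a power of \<open>b ^ n\<close> and as a power of
  \<open>b ^ m\<close>; a common power of \<open>b\<close> cancels.\<close>

lemma deriv_root_eq:
  assumes "0 < n" and "b ^ n \<in> A"
  shows "of_nat n * \<iota> b ^ (n - 1) * deriv_root b = \<iota> (\<delta> (b ^ n))"
proof -
  define m where "m = (SOME n. 0 < n \<and> b ^ n \<in> A)"
  have m: "0 < m \<and> b ^ m \<in> A"
    unfolding m_def by (rule someI[of _ n]) (use assms in auto)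
  have root: "deriv_root b = \<iota> (\<delta> (b ^ m)) / (of_nat m * \<iota> b ^ (m - 1))"
    by (simp add: deriv_root_def m_def Let_def)
  show ?thesis
  proof (cases "b = 0")
    case True
    then show ?thesis
      using assms m derivation_zero[OF subring derivation]
      by (simp add: root[unfolded True] zero_power)
  next
    case False
    obtain p q where pq: "n = Suc p" "m = Suc q"
      using assms(1) m by (metis Suc_pred)
    have "(b ^ n) ^ Suc q = (b ^ m) ^ Suc p"
      by (simp only: power_mult[symmetric] pq mult.commute)
    then have "\<delta> ((b ^ n) ^ Suc q) = \<delta> ((b ^ m) ^ Suc p)" by simp
    then have "of_nat m * (b ^ n) ^ q * \<delta> (b ^ n) = of_nat n * (b ^ m) ^ p * \<delta> (b ^ m)"
      using assms(2) m by (simp only: derivation_power[OF subring derivation] pq)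
    moreover have "(b ^ n) ^ q = b ^ (p * q) * b ^ q" "(b ^ m) ^ p = b ^ (p * q) * b ^ p"
      by (simp_all add: pq ac_simps del: power_Suc flip: power_mult power_add)
    ultimately have "b ^ (p * q) * (of_nat m * b ^ q * \<delta> (b ^ n)) = b ^ (p * q) * (of_nat n * b ^ p * \<delta> (b ^ m))"
      by (simp only: mult_ac)
    then have "of_nat m * b ^ q * \<delta> (b ^ n) = of_nat n * b ^ p * \<delta> (b ^ m)"
      using False by simp
    then have "\<iota> (of_nat m * b ^ q * \<delta> (b ^ n)) = \<iota> (of_nat n * b ^ p * \<delta> (b ^ m))"
      by simp
    then show ?thesis
      using False of_nat_neq_0[of m] m unfolding root
      by (simp del: of_nat_Suc add: pq field_simps)
  qed
qed

lemma deriv_root_unique: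
  assumes "0 < n" and "b ^ n \<in> A" and "b \<noteq> 0"
    and "of_nat n * \<iota> b ^ (n - 1) * e = \<iota> (\<delta> (b ^ n))"
  shows "deriv_root b = e"
  using deriv_root_eq[OF assms(1,2)] assms(3,4) of_nat_neq_0[OF assms(1)]
  by (metis emb_eq_0_iff mult_cancel_left mult_eq_0_iff power_not_zero)

lemma deriv_root_of_base: "a \<in> A \<Longrightarrow> deriv_root a = \<iota> (\<delta> a)"
  using deriv_root_eq[of 1 a] by simp

text \<open>With the common exponent \<open>n * m\<close> both powers lie in \<open>A\<close>. The
  product rule for \<open>\<delta>\<close> there, divided by
  \<open>n * m * (b * c) ^ (n * m - 1)\<close>, is the one for the roots.\<close>

lemma deriv_root_mult:
  assumes "0 < n" "b ^ n \<in> A" and "0 < m" "c ^ m \<in> A"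
  shows "deriv_root (b * c) = deriv_root b * \<iota> c + \<iota> b * deriv_root c"
proof (cases "b * c = 0")
  case True
  moreover have "deriv_root 0 = 0"
    using deriv_root_of_base[of 0] subring_zero[OF subring] derivation_zero[OF subring derivation]
    by simp
  ultimately show ?thesis by auto
next
  case False
  define k where "k = n * m - 1"
  have k: "n * m = Suc k" using assms by (simp add: k_def)
  have pow: "b ^ Suc k \<in> A" "c ^ Suc k \<in> A"
    using subring_power[OF subring assms(2), of m] subring_power[OF subring assms(4), of n]
    by (simp_all only: power_mult[symmetric] k mult.commute[of m n])
  show ?thesis
  proof (rule deriv_root_unique)
    show "0 < Suc k" by simp
    show "(b * c) ^ Suc k \<in> A"
      using pow by (simp only: power_mult_distrib subring_mult[OF subring])
    show "b * c \<noteq> 0" by fact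
    have "\<iota> (\<delta> ((b * c) ^ Suc k)) = \<iota> (\<delta> (b ^ Suc k)) * \<iota> c ^ Suc k + \<iota> b ^ Suc k * \<iota> (\<delta> (c ^ Suc k))"
      by (simp only: power_mult_distrib derivation_mult[OF derivation pow] emb_add emb_mult emb_power)
    also have "\<dots> = of_nat (Suc k) * \<iota> (b * c) ^ k * (deriv_root b * \<iota> c + \<iota> b * deriv_root c)"
      unfolding deriv_root_eq[OF zero_less_Suc pow(1), symmetric]
        deriv_root_eq[OF zero_less_Suc pow(2), symmetric]
      by (simp del: of_nat_Suc add: power_mult_distrib algebra_simps)
    finally show "of_nat (Suc k) * \<iota> (b * c) ^ (Suc k - 1) * (deriv_root b * \<iota> c + \<iota> b * deriv_root c)
      = \<iota> (\<delta> ((b * c) ^ Suc k))" by simp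
  qed
qed

text \<open>Multiplication by \<open>c ^ (n - 1)\<close> moves \<open>b\<close> and \<open>b'\<close> into \<open>A\<close>, where additivity is known.\<close>
lemma deriv_root_add:
  assumes "0 < n" and "c \<noteq> 0" and c: "c ^ n \<in> A"
    and b: "b ^ n \<in> A" "b * c ^ (n - 1) \<in> A"
    and b': "b' ^ n \<in> A" "b' * c ^ (n - 1) \<in> A"
    and bb': "(b + b') ^ n \<in> A"
  shows "deriv_root (b + b') = deriv_root b + deriv_root b'"
proof -
  define d where "d = c ^ (n - 1)"
  have d: "d ^ n \<in> A"
    using subring_power[OF subring c, of "n - 1"]
    by (simp add: d_def flip: power_mult) (simp add: mult.commute)
  have "d \<noteq> 0" using assms(2) by (simp add: d_def)
  have mult: "deriv_root (x * d) = deriv_root x * \<iota> d + \<iota> x * deriv_root d" if "x ^ n \<in> A" for x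
    using that d assms(1) by (intro deriv_root_mult[of n _ n])
  have "\<delta> ((b + b') * d) = \<delta> (b * d) + \<delta> (b' * d)"
    using b(2) b'(2) derivation_add[OF derivation] by (simp add: d_def distrib_right)
  moreover have "(b + b') * d \<in> A"
    using b(2) b'(2) subring_add[OF subring] by (simp add: d_def distrib_right)
  ultimately have "deriv_root ((b + b') * d) = deriv_root (b * d) + deriv_root (b' * d)"
    using b(2) b'(2) by (simp add: deriv_root_of_base d_def)
  \<comment> \<open>After expansion by the product rule, the terms containing
    \<open>deriv_root d\<close> agree on both sides and cancel.\<close>
  then have "deriv_root (b + b') * \<iota> d = (deriv_root b + deriv_root b') * \<iota> d"
    using mult[OF b(1)] mult[OF b'(1)] mult[OF bb'] by (simp add: algebra_simps)
  then show ?thesis using \<open>d \<noteq> 0\<close> by simp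
qed

end

subsection \<open>Locally nilpotent derivations\<close>

text \<open>For nonzero \<open>x\<close> this is the last order of derivation that does not
  annihilate \<open>x\<close>. A derivation gives 0 the degree 0 and not minus infinity, so
  additivity is stated for nonzero factors.\<close>

definition lnd_degree :: "('a::zero \<Rightarrow> 'a) \<Rightarrow> 'a \<Rightarrow> nat"
  where "lnd_degree D x = (LEAST n. (D ^^ Suc n) x = 0)"

locale lnd =
  fixes A :: "'b::idom set" and D :: "'b \<Rightarrow> 'b"
  assumes subring: "is_subring A" and derivation: "D \<in> derivations A"
    and nilpotent: "locally_nilpotent A D"
    and char_0: "0 < n \<Longrightarrow> (of_nat n :: 'b) \<noteq> 0"
begin

lemma funpow_lnd_degree_neq_0:
  assumes "x \<noteq> 0"
  shows "(D ^^ lnd_degree D x) x \<noteq> 0"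
proof (cases "lnd_degree D x")
  case 0
  then show ?thesis using assms by simp
next
  case (Suc n)
  then show ?thesis
    using not_less_Least[of n "\<lambda>n. (D ^^ Suc n) x = 0"] by (simp add: lnd_degree_def)
qed

lemma funpow_above_lnd_degree:
  assumes "x \<in> A" "lnd_degree D x < n"
  shows "(D ^^ n) x = 0"
proof -
  obtain m where "0 < m" "(D ^^ m) x = 0"
    using nilpotent assms(1) unfolding locally_nilpotent_def by blast
  then have "\<exists>k. (D ^^ Suc k) x = 0" by (metis Suc_pred)
  then have "(D ^^ Suc (lnd_degree D x)) x = 0"
    unfolding lnd_degree_def by (rule LeastI_ex)
  moreover obtain k where "n = k + Suc (lnd_degree D x)"
    using assms(2) by (metis add.commute less_iff_Suc_add add_Suc_right)
  ultimately show ?thesis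
    by (simp only: funpow_add o_apply derivation_funpow_zero[OF subring derivation])
qed

lemma lnd_degree_eqI:
  assumes "x \<in> A" "(D ^^ n) x \<noteq> 0" "(D ^^ Suc n) x = 0"
  shows "lnd_degree D x = n"
proof (rule antisym)
  show "lnd_degree D x \<le> n"
    unfolding lnd_degree_def by (rule Least_le) fact
  show "n \<le> lnd_degree D x"
    using funpow_above_lnd_degree[OF assms(1), of n] assms(2) by (meson not_le)
qed

lemma funpow_mult:
  assumes "x \<in> A" "y \<in> A"
  shows "(D ^^ n) (x * y) = (\<Sum>k\<le>n. of_nat (n choose k) * ((D ^^ k) x * (D ^^ (n - k)) y))"
proof -
  have D_of_nat: "D (of_nat k * z) = of_nat k * D z" if "z \<in> A" for k z
  proof -
    have "of_nat k * z \<in> A \<and> D (of_nat k * z) = of_nat k * D z"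
      using that by (induction k)
        (auto simp: derivation_zero[OF subring derivation] subring_zero[OF subring] distrib_right
          subring_add[OF subring] derivation_add[OF derivation])
    then show ?thesis by blast
  qed
  have of_nat_in: "of_nat k * z \<in> A" if "z \<in> A" for k z
    using that by (induction k) (auto simp: subring_zero[OF subring] distrib_right subring_add[OF subring])
  define t where "t i j = (D ^^ i) x * (D ^^ j) y" for i j
  have t: "t i j \<in> A" "D (t i j) = t (Suc i) j + t i (Suc j)" for i j
    using assms derivation_funpow_closed[OF derivation]
    by (auto simp: t_def subring_mult[OF subring] derivation_mult[OF derivation])
  have "(D ^^ n) (x * y) = (\<Sum>k\<le>n. of_nat (n choose k) * t k (n - k))"
  proof (induction n)
    case 0
    then show ?case by (simp add: t_def)
  next
    case (Suc n)
    have "(D ^^ Suc n) (x * y) = D (\<Sum>k\<le>n. of_nat (n choose k) * t k (n - k))"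
      by (simp add: Suc)
    also have "\<dots> = (\<Sum>k\<le>n. D (of_nat (n choose k) * t k (n - k)))"
      using derivation_sum[OF subring derivation, of "{..n}" "\<lambda>k. of_nat (n choose k) * t k (n - k)"]
      by (simp add: of_nat_in t)
    also have "\<dots> = (\<Sum>k\<le>n. of_nat (n choose k) * t (Suc k) (n - k)) + (\<Sum>k\<le>n. of_nat (n choose k) * t k (Suc n - k))"
      by (simp add: D_of_nat t distrib_left sum.distrib Suc_diff_le)
    \<comment> \<open>The added term has the coefficient \<open>n choose Suc n = 0\<close>.
      Splitting off \<open>k = 0\<close> and shifting lines the two sums up for Pascal's
      rule.\<close>
    also have "(\<Sum>k\<le>n. of_nat (n choose k) * t k (Suc n - k)) = (\<Sum>k\<le>Suc n. of_nat (n choose k) * t k (Suc n - k))"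
      by (simp add: binomial_eq_0)
    also have "\<dots> = t 0 (Suc n) + (\<Sum>k\<le>n. of_nat (n choose Suc k) * t (Suc k) (n - k))"
      by (subst sum.atMost_Suc_shift) simp
    finally have "(D ^^ Suc n) (x * y) = t 0 (Suc n) +
        (\<Sum>k\<le>n. of_nat (n choose k) * t (Suc k) (n - k) + of_nat (n choose Suc k) * t (Suc k) (n - k))"
      by (simp add: sum.distrib algebra_simps)
    also have "\<dots> = (\<Sum>k\<le>Suc n. of_nat (Suc n choose k) * t k (Suc n - k))"
      by (subst sum.atMost_Suc_shift) (simp add: distrib_right)
    finally show ?case .
  qed
  then show ?thesis by (simp add: t_def)
qed

text \<open>With degrees \<open>p\<close> and \<open>q\<close>, Leibniz' rule of order
  \<open>p + q\<close> retains only the term \<open>k = p\<close>, as any other term derives one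
  factor too often. Its binomial coefficient is nonzero in characteristic 0, and at order
  \<open>p + q + 1\<close> no term survives.\<close>

lemma lnd_degree_mult:
  assumes "x \<in> A" "y \<in> A" "x \<noteq> 0" "y \<noteq> 0"
  shows "lnd_degree D (x * y) = lnd_degree D x + lnd_degree D y"
proof (rule lnd_degree_eqI)
  let ?p = "lnd_degree D x" and ?q = "lnd_degree D y"
  show "x * y \<in> A" using assms subring by (simp add: subring_mult)
  have zero: "(D ^^ k) x * (D ^^ l) y = 0" if "?p < k \<or> ?q < l" for k l
    using that funpow_above_lnd_degree assms(1,2) by auto
  have "(D ^^ (?p + ?q)) (x * y) =
      (\<Sum>k\<le>?p + ?q. of_nat (?p + ?q choose k) * ((D ^^ k) x * (D ^^ (?p + ?q - k)) y))"
    by (rule funpow_mult) fact+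
  also have "\<dots> = (\<Sum>k\<in>{?p}. of_nat (?p + ?q choose k) * ((D ^^ k) x * (D ^^ (?p + ?q - k)) y))"
  proof (rule sum.mono_neutral_right)
    show "\<forall>k\<in>{..?p + ?q} - {?p}.
        of_nat (?p + ?q choose k) * ((D ^^ k) x * (D ^^ (?p + ?q - k)) y) = 0"
    proof
      fix k assume "k \<in> {..?p + ?q} - {?p}"
      then have "?p < k \<or> ?q < ?p + ?q - k" by auto
      from zero[OF this] show "of_nat (?p + ?q choose k) * ((D ^^ k) x * (D ^^ (?p + ?q - k)) y) = 0"
        by simp
    qed
  qed auto
  also have "\<dots> \<noteq> 0"
    using char_0[of "?p + ?q choose ?p"] funpow_lnd_degree_neq_0 assms by (simp add: zero_less_binomial)
  finally show "(D ^^ (?p + ?q)) (x * y) \<noteq> 0" .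
  show "(D ^^ Suc (?p + ?q)) (x * y) = 0"
    unfolding funpow_mult[OF assms(1,2)]
  proof (intro sum.neutral ballI)
    fix k
    have "?p < k \<or> ?q < Suc (?p + ?q) - k" by auto
    from zero[OF this] show "of_nat (Suc (?p + ?q) choose k) * ((D ^^ k) x * (D ^^ (Suc (?p + ?q) - k)) y) = 0"
      by simp
  qed
qed

lemma lnd_degree_power:
  assumes "x \<in> A" "x \<noteq> 0"
  shows "lnd_degree D (x ^ Suc n) = Suc n * lnd_degree D x"
proof (induction n)
  case (Suc n)
  then show ?case
    using lnd_degree_mult[of x "x ^ Suc n"] assms subring_power[OF subring assms(1), of "Suc n"] by simp
qed simp

lemma lnd_degree_derivative:
  assumes "x \<in> A" "D x \<noteq> 0"
  shows "lnd_degree D x = Suc (lnd_degree D (D x))"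
proof (rule lnd_degree_eqI)
  have Dx: "D x \<in> A" using assms(1) derivation by (rule derivation_closed[rotated])
  show "(D ^^ Suc (lnd_degree D (D x))) x \<noteq> 0"
    using funpow_lnd_degree_neq_0[OF assms(2)] by (simp only: funpow_Suc_right o_apply not_False_eq_True)
  show "(D ^^ Suc (Suc (lnd_degree D (D x)))) x = 0"
    using funpow_above_lnd_degree[OF Dx, of "Suc (lnd_degree D (D x))"] by (simp only: funpow_Suc_right o_apply)
qed fact

text \<open>
  Writing \<open>a\<close> and \<open>c\<close> for the \<open>n\<close>-th powers of \<open>b\<close> and of a derivative \<open>b'\<close> of \<open>b\<close>, the hypothesis
  is the \<open>n\<close>-th power of the equation \<open>D (b ^ n) = n * b ^ (n - 1) * b'\<close>.
\<close>
lemma lnd_degree_root_decreasing: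
  assumes "0 < n" "a \<in> A" "c \<in> A" "a \<noteq> 0" "c \<noteq> 0"
    and eq: "D a ^ n = of_nat n ^ n * a ^ (n - 1) * c"
  shows "lnd_degree D c < lnd_degree D a"
proof -
  obtain m where n: "n = Suc m" using assms(1) by (metis Suc_pred)
  have "D a \<noteq> 0"
    using eq assms char_0[OF assms(1)] by (auto simp: n simp del: of_nat_Suc)
  have Da: "D a \<in> A" using assms(2) derivation by (rule derivation_closed[rotated])
  have D1: "D 1 = 0"
    using derivation_mult[OF derivation, of 1 1] subring_one[OF subring]
    by (metis add_cancel_right_right mult.right_neutral mult_1)
  define u :: 'b where "u = of_nat n ^ n"
  have of_nat: "of_nat k \<in> A \<and> D (of_nat k) = 0" for k
    by (induction k)
      (auto simp: subring_zero[OF subring] derivation_zero[OF subring derivation] D1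
        subring_one[OF subring] subring_add[OF subring] derivation_add[OF derivation])
  \<comment> \<open>Integers are constants of \<open>D\<close>, so the numerical factor does not
    contribute to the degree.\<close>
  have u: "u \<in> A" "u \<noteq> 0" "lnd_degree D u = 0"
  proof -
    show "u \<in> A" "u \<noteq> 0"
      using char_0[OF assms(1)] of_nat subring_power[OF subring] by (auto simp: u_def)
    have "D u = 0"
      unfolding u_def using of_nat derivation_power[OF subring derivation, of "of_nat n" m] by (simp add: n del: of_nat_Suc)
    with \<open>u \<in> A\<close> \<open>u \<noteq> 0\<close> show "lnd_degree D u = 0"
      by (intro lnd_degree_eqI) auto
  qed
  have "lnd_degree D (D a ^ n) = lnd_degree D (u * a ^ m * c)"
    using eq by (simp add: u_def n)
  also have "\<dots> = lnd_degree D (a ^ m) + lnd_degree D c"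
    using u assms subring_power[OF subring, of a m] subring_mult[OF subring]
    by (simp add: lnd_degree_mult)
  \<comment> \<open>If \<open>a\<close> has degree \<open>p\<close>, comparing degrees gives
    \<open>n * (p - 1) = (n - 1) * p + lnd_degree D c\<close>, so that \<open>c\<close> has degree
    \<open>p - n\<close>.\<close>
  finally have "n * lnd_degree D (D a) = lnd_degree D (a ^ m) + lnd_degree D c"
    using lnd_degree_power[OF Da \<open>D a \<noteq> 0\<close>, of m] by (simp add: n)
  moreover have "lnd_degree D (a ^ m) + lnd_degree D a = n * lnd_degree D a"
    using lnd_degree_power[OF assms(2,4), of m] lnd_degree_mult[of a "a ^ m"] assms(2,4)
      subring_power[OF subring assms(2), of m] by (simp add: n)
  moreover have "n * lnd_degree D a = n * lnd_degree D (D a) + n"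
    using lnd_degree_derivative[OF assms(2) \<open>D a \<noteq> 0\<close>] by simp
  ultimately show ?thesis using assms(1) by linarith
qed

end

section \<open>Graded rings\<close>

lemma is_subgroup_zero: "is_subgroup H \<Longrightarrow> 0 \<in> H"
  by (simp add: is_subgroup_def)

lemma is_subgroup_diff: "is_subgroup H \<Longrightarrow> x \<in> H \<Longrightarrow> y \<in> H \<Longrightarrow> x - y \<in> H"
  by (simp add: is_subgroup_def)

lemma is_subgroup_add: "is_subgroup H \<Longrightarrow> x \<in> H \<Longrightarrow> y \<in> H \<Longrightarrow> x + y \<in> H"
  using is_subgroup_diff[of H x "0 - y"] is_subgroup_diff[of H 0 y] is_subgroup_zero[of H] by simp

lemma is_subgroup_sum:
  "is_subgroup H \<Longrightarrow> (\<And>i. i \<in> F \<Longrightarrow> f i \<in> H) \<Longrightarrow> sum f F \<in> H"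
  by (induction F rule: infinite_finite_induct) (auto simp: is_subgroup_zero is_subgroup_add)

lemma is_subgroup_group_closure: "is_subgroup (group_closure S)"
  by (auto simp: is_subgroup_def intro: group_closure.diff)

lemma is_subgroup_plus:
  assumes "is_subgroup H" "is_subgroup K"
  shows "is_subgroup (H + K)"
  unfolding is_subgroup_def
proof (intro conjI ballI)
  show "0 \<in> H + K"
    using set_plus_intro[OF assms[THEN is_subgroup_zero]] by simp
next
  fix x y assume "x \<in> H + K" "y \<in> H + K"
  then obtain a b c d where "x = a + b" "a \<in> H" "b \<in> K" "y = c + d" "c \<in> H" "d \<in> K"
    by (auto elim!: set_plus_elim)
  moreover from this have "(a - c) + (b - d) \<in> H + K"
    using assms by (intro set_plus_intro is_subgroup_diff)
  ultimately show "x - y \<in> H + K" by (simp add: algebra_simps)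
qed

section \<open>Homogeneous components and the subrings \<open>part B H\<close>\<close>

locale graded_ring =
  fixes B :: "'g::ab_group_add \<Rightarrow> 'b::comm_ring_1 set"
  assumes grading: "grading B"
begin

lemma subgroup: "is_subgroup (B i)"
  using grading by (simp add: grading_def)

lemma zero_mem [simp]: "0 \<in> B i"
  using subgroup by (rule is_subgroup_zero)

lemma add_mem: "x \<in> B i \<Longrightarrow> y \<in> B i \<Longrightarrow> x + y \<in> B i"
  using subgroup by (rule is_subgroup_add)

lemma of_nat_mult_mem: "b \<in> B i \<Longrightarrow> of_nat n * b \<in> B i"
  by (induction n) (auto simp: distrib_right intro: add_mem)

lemma mult_mem: "x \<in> B i \<Longrightarrow> y \<in> B j \<Longrightarrow> x * y \<in> B (i + j)"
  using grading by (simp add: grading_def)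

definition component :: "'b \<Rightarrow> 'g \<Rightarrow> 'b"
  where "component b = (THE f. (\<forall>i. f i \<in> B i) \<and> finite {i. f i \<noteq> 0} \<and> b = (\<Sum>i | f i \<noteq> 0. f i))"

lemma component_mem: "component b i \<in> B i"
  and finite_component: "finite {i. component b i \<noteq> 0}"
  and component_sum: "b = (\<Sum>i | component b i \<noteq> 0. component b i)"
proof -
  have "\<exists>!f. (\<forall>i. f i \<in> B i) \<and> finite {i. f i \<noteq> 0} \<and> b = (\<Sum>i | f i \<noteq> 0. f i)"
    using grading by (simp add: grading_def)
  from theI'[OF this] show "component b i \<in> B i" "finite {i. component b i \<noteq> 0}"
    "b = (\<Sum>i | component b i \<noteq> 0. component b i)"
    unfolding component_def by auto
qed

lemma component_eqI:
  assumes "\<And>i. f i \<in> B i" and "finite F" and "\<And>i. i \<notin> F \<Longrightarrow> f i = 0" and "b = (\<Sum>i\<in>F. f i)"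
  shows "component b = f"
proof -
  have ex1: "\<exists>!f. (\<forall>i. f i \<in> B i) \<and> finite {i. f i \<noteq> 0} \<and> b = (\<Sum>i | f i \<noteq> 0. f i)"
    using grading by (simp add: grading_def)
  have sub: "{i. f i \<noteq> 0} \<subseteq> F" using assms(3) by blast
  then have "b = (\<Sum>i | f i \<noteq> 0. f i)"
    unfolding assms(4) by (intro sum.mono_neutral_right assms(2)) auto
  then have "(\<forall>i. f i \<in> B i) \<and> finite {i. f i \<noteq> 0} \<and> b = (\<Sum>i | f i \<noteq> 0. f i)"
    using assms(1,2) sub finite_subset by blast
  then show ?thesis
    unfolding component_def by (rule the1_equality[OF ex1])
qed

lemma component_sum_superset:
  assumes "finite F" and "\<And>i. i \<notin> F \<Longrightarrow> component b i = 0"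
  shows "b = (\<Sum>i\<in>F. component b i)"
proof -
  have "(\<Sum>i | component b i \<noteq> 0. component b i) = (\<Sum>i\<in>F. component b i)"
    by (rule sum.mono_neutral_left) (use assms in auto)
  then show ?thesis by (rule trans[OF component_sum])
qed

lemma component_add: "component (x + y) i = component x i + component y i"
proof -
  let ?F = "{i. component x i \<noteq> 0} \<union> {i. component y i \<noteq> 0}"
  have "component (x + y) = (\<lambda>i. component x i + component y i)"
  proof (rule component_eqI)
    show "finite ?F" by (simp add: finite_component)
    then show "x + y = (\<Sum>i\<in>?F. component x i + component y i)"
      unfolding sum.distrib by (intro arg_cong2[where f = "(+)"] component_sum_superset) auto
  qed (auto intro: add_mem component_mem)
  then show ?thesis by simp
qed

lemma component_homogeneous:
  assumes "b \<in> B i"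
  shows "component b j = (if j = i then b else 0)"
proof -
  have "component b = (\<lambda>j. if j = i then b else 0)"
    by (rule component_eqI[where F = "{i}"]) (use assms in auto)
  then show ?thesis by simp
qed

lemma component_mult:
  assumes "b \<in> B j"
  shows "component (x * b) (k + j) = component x k * b"
proof -
  let ?F = "{i. component x i \<noteq> 0}"
  have "component (x * b) = (\<lambda>k. component x (k - j) * b)"
  proof (rule component_eqI)
    show "component x (i - j) * b \<in> B i" for i
      using mult_mem[OF component_mem assms, of x "i - j"] by simp
    show "finite ((\<lambda>i. i + j) ` ?F)"
      by (simp add: finite_component)
    show "component x (i - j) * b = 0" if "i \<notin> (\<lambda>i. i + j) ` ?F" for i
      using that by (metis (mono_tags, lifting) diff_add_cancel imageI mem_Collect_eq mult_zero_left)
    have "x * b = (\<Sum>i\<in>?F. component x i * b)"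
      by (subst component_sum[of x]) (simp only: sum_distrib_right)
    also have "\<dots> = (\<Sum>i\<in>(\<lambda>i. i + j) ` ?F. component x (i - j) * b)"
      by (subst sum.reindex) (auto simp: inj_on_def)
    finally show "x * b = (\<Sum>i\<in>(\<lambda>i. i + j) ` ?F. component x (i - j) * b)" .
  qed
  then show ?thesis by simp
qed

lemma homogeneousI:
  assumes "\<And>j. j \<noteq> i \<Longrightarrow> component b j = 0"
  shows "b \<in> B i"
proof -
  have "b = (\<Sum>j\<in>{i}. component b j)"
    by (rule component_sum_superset) (use assms in auto)
  also have "\<dots> \<in> B i" by (simp add: component_mem)
  finally show ?thesis .
qed

text \<open>The degree-zero component of \<open>1\<close> is a unit element for all homogeneous elements.\<close>
lemma one_mem: "1 \<in> B 0"
proof -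
  \<comment> \<open>Compare the components of \<open>1 * b = b\<close> in degree
    \<open>i\<close>.\<close>
  have e: "component 1 0 * b = b" if "b \<in> B i" for b i
    using component_mult[OF that, of 1 0] component_homogeneous[OF that, of i] by simp
  have "1 = (\<Sum>i | component 1 i \<noteq> 0. component 1 0 * component 1 i)"
    by (rule trans[OF component_sum]) (simp only: e[OF component_mem])
  also have "\<dots> = component 1 0 * 1"
    by (simp only: component_sum[of 1, symmetric] sum_distrib_left[symmetric])
  finally show ?thesis using component_mem[of 1 0] by simp
qed

lemma power_mem: "b \<in> B i \<Longrightarrow> b ^ n \<in> B (\<Sum>_<n. i)"
  by (induction n) (auto simp: one_mem add.commute intro: mult_mem)

lemma part_iff: "b \<in> part B H \<longleftrightarrow> (\<forall>i. component b i \<noteq> 0 \<longrightarrow> i \<in> H)"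
proof
  assume "b \<in> part B H"
  then obtain F f where F: "finite F" "F \<subseteq> H" "\<forall>i\<in>F. f i \<in> B i" "b = (\<Sum>i\<in>F. f i)"
    by (auto simp: part_def)
  have "component b = (\<lambda>i. if i \<in> F then f i else 0)"
    by (rule component_eqI[where F = F]) (use F in auto)
  then show "\<forall>i. component b i \<noteq> 0 \<longrightarrow> i \<in> H" using F(2) by auto
next
  assume "\<forall>i. component b i \<noteq> 0 \<longrightarrow> i \<in> H"
  then show "b \<in> part B H"
    unfolding part_def
    by (intro CollectI exI[of _ "{i. component b i \<noteq> 0}"] exI[of _ "component b"] conjI ballI
        component_sum finite_component component_mem) auto
qed

lemma homogeneous_mem_part: "b \<in> B i \<Longrightarrow> i \<in> H \<Longrightarrow> b \<in> part B H"
  by (auto simp: part_iff component_homogeneous)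

lemma part_mono: "H \<subseteq> H' \<Longrightarrow> part B H \<subseteq> part B H'"
  unfolding part_iff subset_iff by blast

lemma part_add: "x \<in> part B H \<Longrightarrow> y \<in> part B H \<Longrightarrow> x + y \<in> part B H"
  unfolding part_iff component_add by (metis add_0)

lemma part_zero: "0 \<in> part B H"
  using component_homogeneous[OF zero_mem] by (simp add: part_iff)

lemma part_induct [consumes 1, case_names zero homogeneous add]:
  assumes "x \<in> part B H" and "P 0"
    and "\<And>i b. i \<in> H \<Longrightarrow> b \<in> B i \<Longrightarrow> P b"
    and "\<And>x y. x \<in> part B H \<Longrightarrow> y \<in> part B H \<Longrightarrow> P x \<Longrightarrow> P y \<Longrightarrow> P (x + y)"
  shows "P x"
proof -
  have "(\<Sum>i\<in>F. component x i) \<in> part B H \<and> P (\<Sum>i\<in>F. component x i)"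
    if "finite F" "F \<subseteq> {i. component x i \<noteq> 0}" for F
    using that
  proof (induction F rule: finite_induct)
    case empty
    then show ?case using assms(2) part_zero by simp
  next
    case (insert i F)
    then have "i \<in> H" using assms(1) by (auto simp: part_iff)
    then show ?case
      using insert assms(3)[OF _ component_mem] assms(4) part_add homogeneous_mem_part[OF component_mem]
      by simp
  qed
  from this[OF finite_component subset_refl] show ?thesis
    by (simp flip: component_sum)
qed

lemma part_mult:
  assumes H: "is_subgroup H" and x: "x \<in> part B H" and y: "y \<in> part B H"
  shows "x * y \<in> part B H"
  using x
proof (induction rule: part_induct)
  case zero
  show ?case by (simp add: part_zero)
next
  case (homogeneous i b)
  from y show ?case
  proof (induction rule: part_induct)
    case zero
    show ?case by (simp add: part_zero)
  next
    case (homogeneous j c)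
    then show ?case
      using mult_mem[OF \<open>b \<in> B i\<close>, of c j] H \<open>i \<in> H\<close> by (auto intro: homogeneous_mem_part is_subgroup_add)
  qed (simp add: distrib_left part_add)
qed (simp add: distrib_right part_add)

lemma part_subring:
  assumes "is_subgroup H"
  shows "is_subring (part B H)"
  unfolding is_subring_def
proof (intro conjI ballI)
  show one: "1 \<in> part B H"
    using one_mem is_subgroup_zero[OF assms] by (rule homogeneous_mem_part)
  fix x y assume xy: "x \<in> part B H" "y \<in> part B H"
  then show "x * y \<in> part B H" by (rule part_mult[OF assms])
  have "- 1 \<in> B 0"
    using is_subgroup_diff[OF subgroup zero_mem one_mem] by simp
  then have "- 1 \<in> part B H"
    using is_subgroup_zero[OF assms] by (rule homogeneous_mem_part)
  then have "- 1 * y \<in> part B H"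
    using xy(2) by (rule part_mult[OF assms])
  then show "x - y \<in> part B H" using part_add[OF xy(1), of "- y"] by simp
qed

section \<open>Derivations obtained from maps on homogeneous elements\<close>

definition homogeneous_extension :: "('b \<Rightarrow> 'b) \<Rightarrow> 'b \<Rightarrow> 'b"
  where "homogeneous_extension e x = (\<Sum>i | component x i \<noteq> 0. e (component x i))"

context
  fixes H and e :: "'b \<Rightarrow> 'b"
  assumes H: "is_subgroup H"
    and e_mem: "\<And>i b. i \<in> H \<Longrightarrow> b \<in> B i \<Longrightarrow> e b \<in> part B H"
    and e_add: "\<And>i b c. i \<in> H \<Longrightarrow> b \<in> B i \<Longrightarrow> c \<in> B i \<Longrightarrow> e (b + c) = e b + e c"
    and e_mult: "\<And>i j b c. i \<in> H \<Longrightarrow> j \<in> H \<Longrightarrow> b \<in> B i \<Longrightarrow> c \<in> B j \<Longrightarrow> e (b * c) = e b * c + b * e c"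
begin

lemma e_zero: "e 0 = 0"
  using e_add[OF is_subgroup_zero[OF H] zero_mem zero_mem] by simp

lemma homogeneous_extension_superset:
  assumes "finite F" "\<And>i. i \<notin> F \<Longrightarrow> component x i = 0"
  shows "homogeneous_extension e x = (\<Sum>i\<in>F. e (component x i))"
  unfolding homogeneous_extension_def
  by (rule sum.mono_neutral_left) (use assms e_zero in auto)

lemma homogeneous_extension_homogeneous: "b \<in> B i \<Longrightarrow> homogeneous_extension e b = e b"
  by (subst homogeneous_extension_superset[where F = "{i}"]) (auto simp: component_homogeneous)

lemma homogeneous_extension_add:
  assumes "x \<in> part B H" "y \<in> part B H"
  shows "homogeneous_extension e (x + y) = homogeneous_extension e x + homogeneous_extension e y"
proof -
  let ?F = "{i. component x i \<noteq> 0} \<union> {i. component y i \<noteq> 0}"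
  have F: "finite ?F" by (simp add: finite_component)
  have "homogeneous_extension e (x + y) = (\<Sum>i\<in>?F. e (component (x + y) i))"
    by (rule homogeneous_extension_superset[OF F]) (auto simp: component_add)
  also have "\<dots> = (\<Sum>i\<in>?F. e (component x i) + e (component y i))"
    using assms by (intro sum.cong) (auto simp: component_add part_iff intro!: e_add component_mem)
  also have "\<dots> = homogeneous_extension e x + homogeneous_extension e y"
    unfolding sum.distrib
    by (subst (1 2) homogeneous_extension_superset[OF F]) auto
  finally show ?thesis .
qed

lemma homogeneous_extension_mem:
  "x \<in> part B H \<Longrightarrow> homogeneous_extension e x \<in> part B H"
  by (induction rule: part_induct)
    (simp_all add: homogeneous_extension_homogeneous[OF zero_mem] e_zero part_zero
      homogeneous_extension_homogeneous e_mem homogeneous_extension_add part_add)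

lemma homogeneous_extension_mult:
  assumes "x \<in> part B H" "y \<in> part B H"
  shows "homogeneous_extension e (x * y) = homogeneous_extension e x * y + x * homogeneous_extension e y"
  using assms(1)
proof (induction rule: part_induct)
  case zero
  show ?case by (simp add: homogeneous_extension_homogeneous[OF zero_mem] e_zero)
next
  case (homogeneous i b)
  have b: "b \<in> part B H" using homogeneous by (auto intro: homogeneous_mem_part)
  from assms(2) show ?case
  proof (induction rule: part_induct)
    case zero
    show ?case by (simp add: homogeneous_extension_homogeneous[OF zero_mem] e_zero)
  next
    case (homogeneous j c)
    then show ?case
      using \<open>i \<in> H\<close> \<open>b \<in> B i\<close> mult_mem[of b i c j]
      by (simp add: homogeneous_extension_homogeneous e_mult)
  next
    case (add y z)
    then show ?case
      using b by (simp add: distrib_left homogeneous_extension_add part_mult[OF H] algebra_simps)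
  qed
next
  case (add x z)
  then show ?case
    using assms(2) by (simp add: distrib_right homogeneous_extension_add part_mult[OF H] algebra_simps)
qed

lemma homogeneous_extension_derivation:
  "(\<lambda>x\<in>part B H. homogeneous_extension e x) \<in> derivations (part B H)"
  by (auto simp: derivations_def homogeneous_extension_mem homogeneous_extension_add
      homogeneous_extension_mult part_add part_mult[OF H])

end

lemma derivation_power_homogeneous:
  assumes "is_subgroup H" "D \<in> derivations (part B H)" "i \<in> H" "b \<in> B i"
  shows "D b * (of_nat (Suc m) * b ^ m) = D (b ^ Suc m)"
  using derivation_power[OF part_subring[OF assms(1)] assms(2) homogeneous_mem_part[OF assms(4,3)], of m]
  by (simp only: mult_ac)

text \<open>A nonzero element of degree \<open>i\<close> puts \<open>i\<close> into
  \<open>GG B\<close>, the group to which the torsion condition refers.\<close>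

lemma torsion_exponent:
  assumes "H \<in> TT B" "b \<in> B i" "b \<noteq> 0"
  obtains n :: nat where "0 < n" "(\<Sum>_<n. i) \<in> H"
proof -
  have "B i \<noteq> {0}" using assms by blast
  then have "i \<in> GG B" unfolding GG_def by (auto intro: group_closure.base)
  moreover have "\<forall>i\<in>GG B. \<exists>n>0. (\<Sum>_<(n::nat). i) \<in> H \<inter> GG B"
    using assms(1) by (simp add: TT_def torsion_quotient_def)
  ultimately have "\<exists>n>0. (\<Sum>_<(n::nat). i) \<in> H" by blast
  then show thesis using that by blast
qed

end

locale graded_domain = graded_ring B for B :: "'g::ab_group_add \<Rightarrow> 'b::idom set"
begin

text \<open>In a domain, multiplication by \<open>b\<close> shifts the components of
  \<open>x\<close> by \<open>j\<close> without annihilating any of them.\<close>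

lemma mult_mem_part_cancel:
  assumes "is_subgroup H" "b \<in> B j" "b \<noteq> 0" "j \<in> H" "x * b \<in> part B H"
  shows "x \<in> part B H"
  unfolding part_iff
proof (intro allI impI)
  fix i assume "component x i \<noteq> 0"
  then have "component (x * b) (i + j) \<noteq> 0"
    using assms(2,3) by (simp add: component_mult)
  then have "i + j \<in> H" using assms(5) by (auto simp: part_iff)
  then show "i \<in> H" using is_subgroup_diff[OF assms(1) _ assms(4), of "i + j"] by simp
qed

lemma mult_mem_cancel:
  assumes "b \<in> B j" "b \<noteq> 0" "x * b \<in> B (i + j)"
  shows "x \<in> B i"
proof (rule homogeneousI)
  fix k assume "k \<noteq> i"
  then have "component (x * b) (k + j) = 0"
    using component_homogeneous[OF assms(3), of "k + j"] by simp
  then show "component x k = 0"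
    using assms(1,2) by (simp add: component_mult)
qed

end

section \<open>Extension of derivations\<close>

lemma prime_ideal_zero_mem: "prime_ideal P \<Longrightarrow> 0 \<in> P"
  by (auto simp: prime_ideal_def intro: ring_module.subspace_0)

lemma prime_ideal_one_notin:
  assumes "prime_ideal P"
  shows "1 \<notin> P"
proof
  assume "1 \<in> P"
  then have "x \<in> P" for x
    using ring_module.subspace_scale[of P 1 x] assms by (simp add: prime_ideal_def)
  then show False using assms by (auto simp: prime_ideal_def)
qed

lemma prime_ideal_mult_notin: "prime_ideal P \<Longrightarrow> a \<notin> P \<Longrightarrow> b \<notin> P \<Longrightarrow> a * b \<notin> P"
  by (auto simp: prime_ideal_def)

lemma prime_ideal_power_notin: "prime_ideal P \<Longrightarrow> a \<notin> P \<Longrightarrow> a ^ n \<notin> P"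
  by (induction n) (auto simp: prime_ideal_one_notin prime_ideal_mult_notin)

lemma prime_ideal_of_nat_notin:
  fixes P :: "'a::comm_ring_1 set"
  assumes "is_rat_algebra TYPE('a)" "prime_ideal P" "0 < n"
  shows "of_nat n \<notin> P"
proof
  assume "of_nat n \<in> P"
  moreover obtain u :: 'a where "u * of_nat n = 1"
    using rat_algebra_of_nat_unit[OF assms(1,3)] .
  ultimately have "1 \<in> P"
    using assms(2) ring_module.subspace_scale[of P "of_nat n" u] by (simp add: prime_ideal_def)
  then show False using prime_ideal_one_notin[OF assms(2)] by contradiction
qed

text \<open>Since \<open>P\<close> is prime, \<open>MM B P\<close> is a submonoid, and a commutative
  submonoid generates the group of its differences.\<close>

lemma (in graded_ring) Mbar_difference:
  assumes "prime_ideal P" "g \<in> Mbar B P"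
  obtains k l s t where "g = k - l" "s \<in> B k" "s \<notin> P" "t \<in> B l" "t \<notin> P"
proof -
  have MM_zero: "0 \<in> MM B P"
    using one_mem prime_ideal_one_notin[OF assms(1)] by (auto simp: MM_def)
  have MM_add: "i + j \<in> MM B P" if "i \<in> MM B P" "j \<in> MM B P" for i j
    using that mult_mem prime_ideal_mult_notin[OF assms(1)] unfolding MM_def by blast
  have "\<exists>k\<in>MM B P. \<exists>l\<in>MM B P. g = k - l"
    using assms(2) unfolding Mbar_def
  proof (induction rule: group_closure.induct)
    case (base s)
    then have "s \<in> MM B P" using MM_zero by auto
    then show ?case using MM_zero by (intro bexI[of _ s] bexI[of _ 0]) auto
  next
    case (diff s t)
    then obtain k l k' l' where kl: "k \<in> MM B P" "l \<in> MM B P" "s = k - l"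
      "k' \<in> MM B P" "l' \<in> MM B P" "t = k' - l'" by blast
    then show ?case
      by (intro bexI[of _ "k + l'"] bexI[of _ "l + k'"]) (auto simp: MM_add)
  qed
  then show thesis using that unfolding MM_def by blast
qed

section \<open>The subgroup \<open>Gbar B\<close> and the family \<open>TT B\<close>\<close>

lemma Gbar_subgroup: "is_subgroup (Gbar (B :: 'g::ab_group_add \<Rightarrow> 'b::comm_ring_1 set))"
proof (cases "(Spec1 :: 'b set set) = {}")
  case True
  then show ?thesis by (simp add: Gbar_def GG_def is_subgroup_group_closure)
next
  case False
  then show ?thesis
    by (auto simp: Gbar_def Mbar_def is_subgroup_def intro: group_closure.diff)
qed

lemma subset_plus_Gbar: "H \<subseteq> H + Gbar B"
  using set_plus_intro[OF _ is_subgroup_zero[OF Gbar_subgroup]] by fastforce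

lemma TT_subgroup: "H \<in> TT B \<Longrightarrow> is_subgroup H"
  by (simp add: TT_def)

lemma TT_plus_Gbar: "H \<in> TT B \<Longrightarrow> H + Gbar B \<in> TT B"
  using subset_plus_Gbar[of H B] is_subgroup_plus[OF _ Gbar_subgroup, of H B]
  unfolding TT_def torsion_quotient_def by blast

locale noetherian_normal_graded = graded_domain B for B :: "'g::ab_group_add \<Rightarrow> 'b::idom set" +
  assumes noetherian: "noetherian TYPE('b)" and normal: "normal_domain TYPE('b)"
    and rat_algebra: "is_rat_algebra TYPE('b)"
begin

lemma char_0: "0 < n \<Longrightarrow> (of_nat n :: 'b) \<noteq> 0"
  using rat_algebra_of_nat_unit[OF rat_algebra, of n] by (metis mult_zero_right zero_neq_one)

lemma torsion_power_mem:
  assumes "H \<in> TT B" "b \<in> B i"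
  obtains n where "0 < n" "b ^ n \<in> part B H"
proof (cases "b = 0")
  case True
  then show thesis using that[of 1] part_zero by simp
next
  case False
  with torsion_exponent[OF assms] show thesis
    using that power_mem[OF assms(2)] homogeneous_mem_part by metis
qed

section \<open>Existence of the extended derivation\<close>

context
  fixes H \<delta>
  assumes H: "H \<in> TT B" and \<delta>: "\<delta> \<in> derivations (part B H)"
begin

interpretation root_derivation "part B H" \<delta> to_fract
  by unfold_locales (simp_all add: part_subring TT_subgroup[OF H] \<delta> char_0)

lemma deriv_root_zero: "deriv_root 0 = 0"
  using deriv_root_of_base[OF part_zero] derivation_zero[OF subring \<delta>] by simp

text \<open>By the defining equation \<open>n * s ^ (n - 1)\<close> is a denominator of the
  derivative. It avoids \<open>P\<close> because positive integers are units.\<close>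

lemma deriv_root_local:
  assumes "prime_ideal P" "s \<in> B k" "s \<notin> P"
  shows "\<exists>u. u \<notin> P \<and> to_fract u * deriv_root s \<in> range to_fract"
proof -
  obtain n where n: "0 < n" "s ^ n \<in> part B H"
    using torsion_power_mem[OF H assms(2)] .
  show ?thesis
  proof (intro exI conjI)
    show "of_nat n * s ^ (n - 1) \<notin> P"
      using assms n by (intro prime_ideal_mult_notin prime_ideal_of_nat_notin[OF rat_algebra] prime_ideal_power_notin)
    show "to_fract (of_nat n * s ^ (n - 1)) * deriv_root s \<in> range to_fract"
      using deriv_root_eq[OF n] by simp
  qed
qed

text \<open>
  If \<open>i = h + deg s - deg t\<close> with \<open>h \<in> H\<close> and \<open>s, t \<notin> P\<close>, then \<open>b * t * s ^ (n - 1)\<close> has degree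
  \<open>h + n * deg s\<close>, which is in \<open>H\<close> for a suitable \<open>n\<close>.
\<close>
lemma deriv_root_local_plus_Gbar:
  assumes P: "P \<in> Spec1" and i: "i \<in> H + Gbar B" and b: "b \<in> B i"
  shows "\<exists>u. u \<notin> P \<and> to_fract u * deriv_root b \<in> range to_fract"
proof -
  have prime: "prime_ideal P" using P by (simp add: Spec1_def)
  obtain h g where hg: "i = h + g" "h \<in> H" "g \<in> Gbar B"
    using i by (rule set_plus_elim)
  \<comment> \<open>\<open>Spec1\<close> contains \<open>P\<close>, so \<open>Gbar B\<close> is
    given by the intersection here.\<close>
  then have "g \<in> Mbar B P"
    using P by (auto simp: Gbar_def split: if_splits)
  then obtain k l s t where g: "g = k - l" and s: "s \<in> B k" "s \<notin> P" and t: "t \<in> B l" "t \<notin> P"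
    by (rule Mbar_difference[OF prime])
  have "s \<noteq> 0" using s prime_ideal_zero_mem[OF prime] by auto
  obtain n :: nat where n: "0 < n" "(\<Sum>_<n. k) \<in> H"
    using torsion_exponent[OF H s(1) \<open>s \<noteq> 0\<close>] .
  obtain m where m: "n = Suc m" using n(1) by (metis Suc_pred)
  define w where "w = t * s ^ m"
  have w_mem: "w \<in> B (l + (\<Sum>_<m. k))"
    unfolding w_def by (intro mult_mem power_mem s t)
  have w: "w \<notin> P"
    unfolding w_def by (intro prime_ideal_mult_notin prime_ideal_power_notin prime s t)
  obtain u v where u: "u \<notin> P" "to_fract u * deriv_root w = to_fract v"
    using deriv_root_local[OF prime w_mem w] by blast
  have "b * w \<in> B (i + (l + (\<Sum>_<m. k)))"
    by (intro mult_mem b w_mem)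
  also have "i + (l + (\<Sum>_<m. k)) = h + (\<Sum>_<n. k)"
    by (simp add: hg g m)
  finally have bw: "b * w \<in> part B H"
    using n(2) hg(2) is_subgroup_add[OF TT_subgroup[OF H]] by (blast intro: homogeneous_mem_part)
  obtain p where p: "0 < p" "b ^ p \<in> part B H" using torsion_power_mem[OF H b] .
  obtain q where q: "0 < q" "w ^ q \<in> part B H" using torsion_power_mem[OF H w_mem] .
  \<comment> \<open>The product rule is solved for the derivative of \<open>b\<close>:
    \<open>u\<close> clears the denominator of the derivative of \<open>w\<close>, and
    \<open>u * w\<close> lies outside of \<open>P\<close>.\<close>
  have "to_fract (\<delta> (b * w)) = deriv_root b * to_fract w + to_fract b * deriv_root w"
    using deriv_root_of_base[OF bw] deriv_root_mult[OF p q] by simp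
  then have "to_fract u * to_fract (\<delta> (b * w)) = to_fract (u * w) * deriv_root b + to_fract b * to_fract v"
    by (simp add: algebra_simps flip: u(2))
  then have "to_fract (u * w) * deriv_root b = to_fract (u * \<delta> (b * w) - b * v)"
    by (simp add: algebra_simps)
  then show ?thesis
    using prime_ideal_mult_notin[OF prime u(1) w] by blast
qed

definition derivative_in_ring :: "'b \<Rightarrow> 'b"
  where "derivative_in_ring b = (SOME c. to_fract c = deriv_root b)"

text \<open>The local statements at all primes of height one place the derivative in the ring. If
  \<open>Spec1\<close> is empty they hold vacuously, and every fraction lies in the ring.\<close>

lemma to_fract_derivative_in_ring:
  assumes "i \<in> H + Gbar B" "b \<in> B i"
  shows "to_fract (derivative_in_ring b) = deriv_root b"
proof -
  have "deriv_root b \<in> range to_fract"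
    by (rule noetherian_normal_Inter_Spec1[OF noetherian normal deriv_root_local_plus_Gbar[OF _ assms]])
  then have "\<exists>c. to_fract c = deriv_root b" by (auto intro: sym)
  then show ?thesis
    unfolding derivative_in_ring_def by (rule someI_ex)
qed

lemma plus_Gbar_subgroup: "is_subgroup (H + Gbar B)"
  using TT_subgroup[OF H] Gbar_subgroup by (rule is_subgroup_plus)

lemma derivative_in_ring_eq:
  assumes "i \<in> H + Gbar B" "b \<in> B i" "0 < n" "b ^ n \<in> part B H"
  shows "of_nat n * b ^ (n - 1) * derivative_in_ring b = \<delta> (b ^ n)"
proof -
  have "to_fract (of_nat n * b ^ (n - 1) * derivative_in_ring b) = to_fract (\<delta> (b ^ n))"
    using deriv_root_eq[OF assms(3,4)] to_fract_derivative_in_ring[OF assms(1,2)] by simp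
  then show ?thesis unfolding to_fract_eq_iff .
qed

text \<open>\<open>\<delta> (b ^ n)\<close> lies in the part, and its factor
  \<open>n * b ^ (n - 1)\<close> is homogeneous with degree in \<open>H + Gbar B\<close>, so it can
  be cancelled.\<close>

lemma derivative_in_ring_mem:
  assumes "i \<in> H + Gbar B" "b \<in> B i"
  shows "derivative_in_ring b \<in> part B (H + Gbar B)"
proof (cases "b = 0")
  case True
  then have "to_fract (derivative_in_ring b) = 0"
    using to_fract_derivative_in_ring[OF assms] deriv_root_zero by simp
  then show ?thesis by (simp add: part_zero)
next
  case False
  obtain n where n: "0 < n" "b ^ n \<in> part B H" using torsion_power_mem[OF H assms(2)] .
  have "derivative_in_ring b * (of_nat n * b ^ (n - 1)) = \<delta> (b ^ n)"
    using derivative_in_ring_eq[OF assms n] by (simp add: mult_ac)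
  also have "\<dots> \<in> part B (H + Gbar B)"
    using derivation_closed[OF \<delta> n(2)] part_mono[OF subset_plus_Gbar] by blast
  finally have prod: "derivative_in_ring b * (of_nat n * b ^ (n - 1)) \<in> part B (H + Gbar B)" .
  have "of_nat n * b ^ (n - 1) \<in> B (\<Sum>_<n - 1. i)"
    by (intro of_nat_mult_mem power_mem assms)
  moreover have "of_nat n * b ^ (n - 1) \<noteq> 0"
    using False char_0[OF n(1)] by simp
  moreover have "(\<Sum>_<n - 1. i) \<in> H + Gbar B"
    using assms by (intro is_subgroup_sum plus_Gbar_subgroup)
  ultimately show ?thesis
    using prod by (rule mult_mem_part_cancel[OF plus_Gbar_subgroup])
qed

lemma derivative_in_ring_add:
  assumes i: "i \<in> H + Gbar B" and b: "b \<in> B i" and c: "c \<in> B i"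
  shows "derivative_in_ring (b + c) = derivative_in_ring b + derivative_in_ring c"
proof -
  have "deriv_root (b + c) = deriv_root b + deriv_root c"
  proof (cases "b = 0 \<and> c = 0")
    case True
    then show ?thesis by (simp add: deriv_root_zero)
  next
    case False
    \<comment> \<open>A nonzero \<open>d\<close> of degree \<open>i\<close> provides an exponent
      that serves all of \<open>B i\<close>, and is the auxiliary factor for
      \<open>deriv_root_add\<close>.\<close>
    then obtain d where d: "d \<in> B i" "d \<noteq> 0" using b c by blast
    obtain n :: nat where n: "0 < n" "(\<Sum>_<n. i) \<in> H"
      using torsion_exponent[OF H d] .
    have pow: "x ^ n \<in> part B H" if "x \<in> B i" for x
      using power_mem[OF that] n(2) by (rule homogeneous_mem_part)
    have mult: "x * d ^ (n - 1) \<in> part B H" if "x \<in> B i" for x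
    proof -
      have "x * d ^ (n - 1) \<in> B (i + (\<Sum>_<n - 1. i))"
        by (intro mult_mem power_mem that d)
      also have "i + (\<Sum>_<n - 1. i) = (\<Sum>_<n. i)"
        using n(1) by (cases n) (simp_all add: add.commute)
      finally show ?thesis using n(2) by (rule homogeneous_mem_part)
    qed
    show ?thesis
      using n(1) d(2) pow[OF d(1)] pow[OF b] mult[OF b] pow[OF c] mult[OF c] pow[OF add_mem[OF b c]]
      by (rule deriv_root_add)
  qed
  then have "to_fract (derivative_in_ring (b + c)) = to_fract (derivative_in_ring b + derivative_in_ring c)"
    using assms add_mem[OF b c] by (simp add: to_fract_derivative_in_ring)
  then show ?thesis unfolding to_fract_eq_iff .
qed

lemma derivative_in_ring_mult:
  assumes i: "i \<in> H + Gbar B" and j: "j \<in> H + Gbar B" and b: "b \<in> B i" and c: "c \<in> B j"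
  shows "derivative_in_ring (b * c) = derivative_in_ring b * c + b * derivative_in_ring c"
proof -
  obtain n where n: "0 < n" "b ^ n \<in> part B H" using torsion_power_mem[OF H b] .
  obtain m where m: "0 < m" "c ^ m \<in> part B H" using torsion_power_mem[OF H c] .
  have "to_fract (derivative_in_ring (b * c)) = to_fract (derivative_in_ring b * c + b * derivative_in_ring c)"
    using deriv_root_mult[OF n m] to_fract_derivative_in_ring[OF is_subgroup_add[OF plus_Gbar_subgroup i j] mult_mem[OF b c]]
    by (simp add: to_fract_derivative_in_ring[OF i b] to_fract_derivative_in_ring[OF j c])
  then show ?thesis unfolding to_fract_eq_iff .
qed

lemma derivation_extends:
  "\<exists>D\<in>derivations (part B (H + Gbar B)). \<forall>a\<in>part B H. D a = \<delta> a"
proof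
  let ?e = "homogeneous_extension derivative_in_ring"
  note facts = plus_Gbar_subgroup derivative_in_ring_mem derivative_in_ring_add derivative_in_ring_mult
  show "(\<lambda>x\<in>part B (H + Gbar B). ?e x) \<in> derivations (part B (H + Gbar B))"
    using facts by (rule homogeneous_extension_derivation)
  have sub: "part B H \<subseteq> part B (H + Gbar B)" by (intro part_mono subset_plus_Gbar)
  have homog: "?e b = \<delta> b" if "i \<in> H" "b \<in> B i" for i b
  proof -
    have "?e b = derivative_in_ring b"
      using facts \<open>b \<in> B i\<close> by (rule homogeneous_extension_homogeneous)
    moreover have "i \<in> H + Gbar B" using that subset_plus_Gbar by blast
    ultimately show ?thesis
      \<comment> \<open>With exponent 1 the defining equation is agreement with
        \<open>\<delta>\<close>.\<close>
      using derivative_in_ring_eq[of i b 1] that homogeneous_mem_part[of b i H] by simp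
  qed
  have "?e a = \<delta> a" if "a \<in> part B H" for a
    using that
  proof (induction rule: part_induct)
    case zero
    then show ?case using homog[OF is_subgroup_zero[OF TT_subgroup[OF H]] zero_mem] by simp
  next
    case (homogeneous i b)
    then show ?case by (rule homog)
  next
    case (add x y)
    then have "?e (x + y) = ?e x + ?e y"
      using sub by (intro homogeneous_extension_add[OF facts]) auto
    then show ?case using add by (simp add: derivation_add[OF \<delta>])
  qed
  then show "\<forall>a\<in>part B H. (\<lambda>x\<in>part B (H + Gbar B). ?e x) a = \<delta> a"
    using sub by auto
qed

end

section \<open>Uniqueness of the extension and the property \<open>EXT\<close>\<close>

lemma derivation_extension_unique:
  assumes H: "H \<in> TT B" and K: "H \<subseteq> K" "is_subgroup K"
    and D: "D \<in> derivations (part B K)" and D': "D' \<in> derivations (part B K)"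
    and eq: "\<And>a. a \<in> part B H \<Longrightarrow> D a = D' a"
  shows "D = D'"
proof
  fix x
  show "D x = D' x"
  proof (cases "x \<in> part B K")
    case False
    \<comment> \<open>Outside of the subring both maps take the fixed value of extensional
      functions.\<close>
    then show ?thesis using D D' by (auto simp: derivations_def PiE_def extensional_def)
  next
    case True
    then show ?thesis
    proof (induction rule: part_induct)
      case zero
      show ?case using eq part_zero by blast
    next
      case (homogeneous i b)
      show ?case
      proof (cases "b = 0")
        case True
        then show ?thesis using eq part_zero by blast
      next
        case False
        obtain n where n: "0 < n" "b ^ n \<in> part B H" using torsion_power_mem[OF H homogeneous(2)] .
        then obtain m where m: "n = Suc m" by (metis Suc_pred)
        \<comment> \<open>The value at \<open>b ^ n\<close> determines the value at
          \<open>b\<close>, because \<open>n * b ^ m\<close> is nonzero in a domain of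
          characteristic 0.\<close>
        have "D b * (of_nat n * b ^ m) = D' b * (of_nat n * b ^ m)"
          using derivation_power_homogeneous[OF K(2) D homogeneous, of m]
            derivation_power_homogeneous[OF K(2) D' homogeneous, of m] eq[OF n(2)] by (simp add: m)
        then show ?thesis using False char_0[OF n(1)] by simp
      qed
    next
      case (add x y)
      then show ?case by (simp add: derivation_add[OF D] derivation_add[OF D'])
    qed
  qed
qed

lemma EXT_plus_Gbar:
  assumes H: "H \<in> TT B"
  shows "EXT (part B H) (part B (H + Gbar B)) (\<lambda>b. b)"
  unfolding EXT_def
proof (intro conjI ballI)
  have sub: "H \<subseteq> H + Gbar B" by (rule subset_plus_Gbar)
  have H': "is_subgroup (H + Gbar B)" using TT_subgroup[OF H] Gbar_subgroup by (rule is_subgroup_plus)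
  show "is_subring (part B H)" "is_subring (part B (H + Gbar B))"
    using TT_subgroup[OF H] H' by (auto intro: part_subring)
  show "is_ring_hom (part B H) (part B (H + Gbar B)) (\<lambda>b. b)"
    using part_mono[OF sub] by (auto simp: is_ring_hom_def)
  fix \<delta> assume \<delta>: "\<delta> \<in> derivations (part B H)"
  obtain D where D: "D \<in> derivations (part B (H + Gbar B))" "\<forall>a\<in>part B H. D a = \<delta> a"
    using derivation_extends[OF H \<delta>] by blast
  then show "\<exists>!D. D \<in> derivations (part B (H + Gbar B)) \<and> (\<forall>a\<in>part B H. D a = \<delta> a)"
    by (intro ex1I[of _ D] conjI) (auto intro: derivation_extension_unique[OF H sub H'])
qed

section \<open>Homogeneous locally nilpotent derivations and the family \<open>XX B\<close>\<close>

lemma zero_HLND: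
  assumes "is_subgroup H"
  shows "(\<lambda>x\<in>part B H. 0) \<in> HLND B H"
proof -
  have "(\<lambda>x\<in>part B H. 0) \<in> derivations (part B H)"
    by (auto simp: derivations_def part_zero part_add part_mult[OF assms])
  moreover have "locally_nilpotent (part B H) (\<lambda>x\<in>part B H. 0)"
    unfolding locally_nilpotent_def by (auto intro!: exI[of _ 1])
  moreover have "\<forall>i\<in>H. (\<lambda>x\<in>part B H. 0) ` B i \<subseteq> B (i + 0)"
    using homogeneous_mem_part by auto
  ultimately show ?thesis
    unfolding HLND_def using is_subgroup_zero[OF assms] by blast
qed

text \<open>Both \<open>D (b ^ n)\<close> and its nonzero factor \<open>n * b ^ (n - 1)\<close> are
  homogeneous, so the other factor \<open>D b\<close> is homogeneous too, and the degrees
  subtract.\<close>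

lemma extension_homogeneous:
  assumes H: "H \<in> TT B" and K: "H \<subseteq> K" "is_subgroup K"
    and D: "D \<in> derivations (part B K)"
    and d: "\<And>i b. i \<in> H \<Longrightarrow> b \<in> B i \<Longrightarrow> D b \<in> B (i + d)"
    and i: "i \<in> K" and b: "b \<in> B i"
  shows "D b \<in> B (i + d)"
proof (cases "b = 0")
  case True
  then show ?thesis using derivation_zero[OF part_subring[OF K(2)] D] by simp
next
  case False
  obtain n :: nat where n: "0 < n" "(\<Sum>_<n. i) \<in> H" using torsion_exponent[OF H b False] .
  then obtain m where m: "n = Suc m" by (metis Suc_pred)
  have pow: "b ^ n \<in> B (\<Sum>_<n. i)" by (rule power_mem[OF b])
  have "D b * (of_nat n * b ^ m) = D (b ^ n)"
    using derivation_power_homogeneous[OF K(2) D i b, of m] by (simp add: m)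
  also have "\<dots> \<in> B ((\<Sum>_<n. i) + d)"
    using n(2) pow by (rule d)
  also have "(\<Sum>_<n. i) + d = (i + d) + (\<Sum>_<m. i)"
    by (simp add: m)
  finally have prod: "D b * (of_nat n * b ^ m) \<in> B ((i + d) + (\<Sum>_<m. i))" .
  have "of_nat n * b ^ m \<in> B (\<Sum>_<m. i)"
    by (intro of_nat_mult_mem power_mem b)
  moreover have "of_nat n * b ^ m \<noteq> 0"
    using False char_0[OF n(1)] by simp
  ultimately show ?thesis using prod by (rule mult_mem_cancel)
qed

text \<open>Induction on the degree of \<open>b ^ n\<close> with respect to \<open>\<delta>\<close>.
  Since \<open>d\<close> lies in \<open>H\<close>, a single exponent \<open>n\<close> takes
  \<open>b\<close> and all its iterated derivatives into \<open>part B H\<close>.\<close>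

lemma extension_nilpotent_homogeneous:
  assumes H: "H \<in> TT B" and K: "H \<subseteq> K" "is_subgroup K"
    and \<delta>: "\<delta> \<in> derivations (part B H)" "locally_nilpotent (part B H) \<delta>"
    and D: "D \<in> derivations (part B K)" and D_eq: "\<And>a. a \<in> part B H \<Longrightarrow> D a = \<delta> a"
    and d: "d \<in> H" "\<And>i b. i \<in> K \<Longrightarrow> b \<in> B i \<Longrightarrow> D b \<in> B (i + d)"
    and i: "i \<in> K" and b: "b \<in> B i"
  shows "\<exists>k>0. (D ^^ k) b = 0"
proof (cases "b = 0")
  case True
  then show ?thesis
    using derivation_zero[OF part_subring[OF K(2)] D] by (intro exI[of _ 1]) simp
next
  case False
  interpret lnd "part B H" \<delta>
    using part_subring[OF TT_subgroup[OF H]] \<delta> char_0 by unfold_locales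
  obtain n :: nat where n: "0 < n" "(\<Sum>_<n. i) \<in> H" using torsion_exponent[OF H b False] .
  then obtain m where m: "n = Suc m" by (metis Suc_pred)
  from i b n(2) show ?thesis
  proof (induction "lnd_degree \<delta> (b ^ n)" arbitrary: b i rule: less_induct)
    case less
    have pow: "b ^ n \<in> part B H" using power_mem[OF less(3)] less(4) by (rule homogeneous_mem_part)
    show ?case
    proof (cases "D b = 0")
      case True
      then show ?thesis by (intro exI[of _ 1]) simp
    next
      case False
      then have b0: "b \<noteq> 0" using derivation_zero[OF part_subring[OF K(2)] D] by auto
      have Db: "D b \<in> B (i + d)" using less(2,3) by (rule d(2))
      have i': "i + d \<in> K" using K d(1) less(2) by (intro is_subgroup_add) auto
      have "(\<Sum>_<n. d) \<in> H" using d(1) by (intro is_subgroup_sum TT_subgroup[OF H])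
      then have n': "(\<Sum>_<n. i + d) \<in> H"
        using less(4) is_subgroup_add[OF TT_subgroup[OF H]] by (simp add: sum.distrib del: sum_constant)
      have Dpow: "D b ^ n \<in> part B H" using power_mem[OF Db] n' by (rule homogeneous_mem_part)
      have "\<delta> (b ^ n) = D b * (of_nat n * b ^ m)"
        using derivation_power_homogeneous[OF K(2) D less(2,3), of m] D_eq[OF pow] by (simp add: m)
      \<comment> \<open>This is the hypothesis of \<open>lnd_degree_root_decreasing\<close> for
        \<open>a = b ^ n\<close> and \<open>c = D b ^ n\<close>, using
        \<open>(b ^ m) ^ n = (b ^ n) ^ m\<close>.\<close>
      then have "\<delta> (b ^ n) ^ n = of_nat n ^ n * (b ^ n) ^ (n - 1) * D b ^ n"
        by (simp add: m power_mult_distrib mult_ac del: of_nat_Suc power_Suc flip: power_mult)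
      then have "lnd_degree \<delta> (D b ^ n) < lnd_degree \<delta> (b ^ n)"
        using n(1) pow Dpow b0 False by (intro lnd_degree_root_decreasing[where n = n]) auto
      from less(1)[OF this i' Db n'] obtain k where "(D ^^ k) (D b) = 0" by blast
      then have "(D ^^ Suc k) b = 0" by (simp only: funpow_Suc_right o_apply)
      then show ?thesis by blast
    qed
  qed
qed

lemma XX_plus_Gbar:
  assumes "H \<in> XX B"
  shows "H + Gbar B \<in> XX B"
proof -
  have H: "H \<in> TT B" and "HLND B H \<noteq> {\<lambda>x\<in>part B H. 0}"
    using assms by (auto simp: XX_def)
  \<comment> \<open>The zero derivation always belongs to the set, so a set other than its singleton
    has a nonzero member.\<close>
  then obtain \<delta> where "\<delta> \<in> HLND B H" and nonzero: "\<delta> \<noteq> (\<lambda>x\<in>part B H. 0)"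
    using zero_HLND[OF TT_subgroup[OF H]] by blast
  then obtain d where \<delta>: "\<delta> \<in> derivations (part B H)" "locally_nilpotent (part B H) \<delta>"
    and d: "d \<in> H" "\<And>i. i \<in> H \<Longrightarrow> \<delta> ` B i \<subseteq> B (i + d)"
    by (auto simp: HLND_def)
  define K where "K = H + Gbar B"
  have K: "H \<subseteq> K" "is_subgroup K"
    unfolding K_def using subset_plus_Gbar is_subgroup_plus[OF TT_subgroup[OF H] Gbar_subgroup] by auto
  obtain D where D: "D \<in> derivations (part B K)" "\<And>a. a \<in> part B H \<Longrightarrow> D a = \<delta> a"
    using derivation_extends[OF H \<delta>(1)] unfolding K_def by blast
  have homog: "D b \<in> B (i + d)" if "i \<in> K" "b \<in> B i" for i b
    using H K D(1) _ that
  proof (rule extension_homogeneous)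
    fix i b assume "i \<in> H" "b \<in> B i"
    then show "D b \<in> B (i + d)" using D(2)[OF homogeneous_mem_part] d(2) by fastforce
  qed
  have "\<exists>k>0. (D ^^ k) x = 0" if "x \<in> part B K" for x
    using that
  proof (induction rule: part_induct)
    case zero
    then show ?case
      using derivation_zero[OF part_subring[OF K(2)] D(1)] by (intro exI[of _ 1]) simp
  next
    case (homogeneous i b)
    then show ?case
      using extension_nilpotent_homogeneous[OF H K \<delta> D d(1) homog] by blast
  next
    case (add x y)
    then obtain k l where kl: "k > 0" "(D ^^ k) x = 0" "(D ^^ l) y = 0" by blast
    have zero: "(D ^^ j) 0 = 0" for j
      by (rule derivation_funpow_zero[OF part_subring[OF K(2)] D(1)])
    have "(D ^^ (l + k)) x = 0"
      by (simp only: funpow_add o_apply kl zero)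
    moreover have "(D ^^ (k + l)) y = 0"
      by (simp only: funpow_add o_apply kl zero)
    ultimately have "(D ^^ (k + l)) (x + y) = 0"
      using add by (simp add: derivation_funpow_add[OF part_subring[OF K(2)] D(1)] add.commute)
    then show ?case using kl(1) by (intro exI[of _ "k + l"]) simp
  qed
  then have "D \<in> HLND B K"
    unfolding HLND_def locally_nilpotent_def using D(1) K(1) d(1) homog by blast
  moreover have "D \<noteq> (\<lambda>x\<in>part B K. 0)"
  proof
    assume "D = (\<lambda>x\<in>part B K. 0)"
    then have "\<delta> a = 0" if "a \<in> part B H" for a
      using D(2)[OF that] that part_mono[OF K(1)] by auto
    then have "\<delta> = (\<lambda>x\<in>part B H. 0)"
      using \<delta>(1) by (auto simp: derivations_def PiE_def extensional_def)
    with nonzero show False by contradiction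
  qed
  ultimately show ?thesis
    using TT_plus_Gbar[OF H] unfolding XX_def K_def by blast
qed

end

theorem theorem5p11:
  fixes B :: "'g::ab_group_add \<Rightarrow> 'b::idom set"
  assumes "fin_gen_group TYPE('g)"
    and "grading B"
    and "noetherian TYPE('b)"
    and "normal_domain TYPE('b)"
    and "is_rat_algebra TYPE('b)"
  shows "(\<forall>H \<in> TT B. EXT (part B H) (part B (H + Gbar B)) (\<lambda>b. b)) \<and>
         (\<forall>H \<in> XX B. H + Gbar B \<in> XX B)"
proof -
  interpret noetherian_normal_graded B
    using assms by unfold_locales
  show ?thesis
    using EXT_plus_Gbar XX_plus_Gbar by blast
qed

end
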